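(* Let $G$ be a connected graph with root $u\in V(G)$, let $n$ be a positive integer, and let $\mathbf{a},\mathbf{b}\in\mathcal{P}(n)$ be two arbitrary partitions of $n$ with $\mathbf{a}\prec_{\mathrm{lex}}\mathbf{b}$ in the shortlex order. Then for every $\alpha\in[0,1)$, $$\rho_\alpha(G(\mathbf{a},u))\le \rho_\alpha(G(\mathbf{b},u)),$$ where equality holds if and only if $G(\mathbf{a},u)\cong G(\mathbf{b},u)$, that is, if and only if $G=K_1$ and the length of $\mathbf{b}$ is $2$.
   Context: Graphs are finite, simple and undirected. $\mathcal{P}(n)$ is the set of all partitions of $n$, written as nondecreasing sequences of positive integers $(n_1,n_2,\ldots,n_d)$ with sum $n$; $d$ is the length of the partition. Shortlex order: for $\mathbf{a}=(a_1,\ldots,a_k)$ and $\mathbf{b}=(b_1,\ldots,b_p)$ in $\mathcal{P}(n)$, $\mathbf{a}\prec_{\mathrm{lex}}\mathbf{b}$ means that either $k<p$, or $k=p$, $\mathbf{a}\neq\mathbf{b}$ and $a_i<b_i$ for the smallest index $i$ at which the two sequences differ. For a connected graph $G$, a vertex $u$ of $G$ and $\mathbf{a}=(n_1,\ldots,n_d)\in\mathcal{P}(n)$, $G(\mathbf{a},u)$ denotes the graph obtained from $G$ by appending $d$ paths of lengths $n_1,\ldots,n_d$ at $u$. That is, for each $i$ one takes a path with $n_i$ edges (on $n_i+1$ vertices) and identifies one of its end vertices with $u$, the paths being otherwise disjoint from each other and from $G$. For a graph $H$ with adjacency matrix $A(H)$ and diagonal matrix of vertex degrees $D(H)$, and for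 $\alpha\in[0,1)$, $A_\alpha(H)=\alpha D(H)+(1-\alpha)A(H)$, and $\rho_\alpha(H)$ denotes the spectral radius (largest eigenvalue) of $A_\alpha(H)$. $K_1$ is the one-vertex graph. *)

theory Defs
  imports
    "Graph_Theory.Graph_Theory"
    "Jordan_Normal_Form.Spectral_Radius"
begin

definition partitions :: "nat \<Rightarrow> nat list set" where
  "partitions n = {xs. sorted xs \<and> (\<forall>x \<in> set xs. 0 < x) \<and> sum_list xs = n}"

text \<open>
  The library relation \<^const>\<open>lenlex\<close> compares lengths first and lists of equal length
  lexicographically from the left.
\<close>

abbreviation shortlex :: "nat list \<Rightarrow> nat list \<Rightarrow> bool" (infix "\<prec>\<^sub>l\<^sub>e\<^sub>x" 50) where
  "xs \<prec>\<^sub>l\<^sub>e\<^sub>x ys \<equiv> (xs, ys) \<in> lenlex {(x, y). x < y}"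

lemma shortlex_iff:
  "xs \<prec>\<^sub>l\<^sub>e\<^sub>x ys \<longleftrightarrow>
    length xs < length ys \<or>
    length xs = length ys \<and> (\<exists>i < length xs. take i xs = take i ys \<and> xs ! i < ys ! i)" (is "?L \<longleftrightarrow> ?R")
proof
  assume ?L
  then show ?R
    by (auto simp: lenlex_conv elim!: lex_take_index)
next
  have "(xs, ys) \<in> lex {(x, y). x < y}"
    if l: "length xs = length ys" and i: "i < length xs"
      and t: "take i xs = take i ys" and x: "xs ! i < ys ! i" for i
  proof -
    have "xs = take i xs @ xs ! i # drop (Suc i) xs"
      using i by (rule id_take_nth_drop)
    moreover have "ys = take i xs @ ys ! i # drop (Suc i) ys"
      unfolding t using i l by (intro id_take_nth_drop) simp
    ultimately show ?thesis
      using l x unfolding lex_conv by blast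
  qed
  moreover assume ?R
  ultimately show ?L
    by (auto simp: lenlex_conv)
qed

text \<open>
  Undirected simple graphs are the symmetric loop-free digraphs of the locale
  \<^locale>\<open>pair_graph\<close>: an edge is represented by its two arcs.

  The \<open>i\<close>-th appended path has the vertices \<open>path_vertex u i 0, \<dots>, path_vertex u i (xs ! i)\<close>;
  the clause for \<open>0\<close> identifies its first vertex with the root \<open>u\<close>.
\<close>

definition path_vertex :: "'a \<Rightarrow> nat \<Rightarrow> nat \<Rightarrow> 'a + nat \<times> nat" where
  "path_vertex u i j = (if j = 0 then Inl u else Inr (i, j))"

definition append_paths :: "'a pair_pre_digraph \<Rightarrow> nat list \<Rightarrow> 'a \<Rightarrow> ('a + nat \<times> nat) pair_pre_digraph"
  where
  "append_paths G xs u =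
    \<lparr> pverts = Inl ` pverts G \<union> {path_vertex u i j | i j. i < length xs \<and> j \<le> xs ! i},
      parcs = map_prod Inl Inl ` parcs G
        \<union> {(path_vertex u i j, path_vertex u i (Suc j)) | i j. i < length xs \<and> j < xs ! i}
        \<union> {(path_vertex u i (Suc j), path_vertex u i j) | i j. i < length xs \<and> j < xs ! i} \<rparr>"

lemma pair_graph_append_paths:
  assumes "pair_graph G" and "u \<in> pverts G"
  shows "pair_graph (append_paths G xs u)"
proof -
  interpret pair_graph G by fact
  have "{path_vertex u i j | i j. i < length xs \<and> j \<le> xs ! i}
      = (\<lambda>(i, j). path_vertex u i j) ` (SIGMA i:{..<length xs}. {..xs ! i})"
    by (auto simp: image_iff)
  then have fin: "finite (pverts (append_paths G xs u))"
    by (simp add: append_paths_def)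
  have "parcs (append_paths G xs u) \<subseteq> pverts (append_paths G xs u) \<times> pverts (append_paths G xs u)"
    by (fastforce simp: append_paths_def dest: in_arcsD1 in_arcsD2 intro: less_imp_le Suc_leI)
  moreover from this fin have "finite (parcs (append_paths G xs u))"
    by (meson finite_SigmaI finite_subset)
  moreover have "symmetric (with_proj (append_paths G xs u))"
    using pair_sym_arcs
    by (auto simp: symmetric_def sym_def append_paths_def map_prod_def image_iff; force)
  moreover have "x \<noteq> y" if "(x, y) \<in> parcs (append_paths G xs u)" for x y
    using that no_loops' by (auto simp: append_paths_def path_vertex_def split: if_splits)
  ultimately show ?thesis
    using fin by unfold_locales auto
qed

text \<open>
  Matrices are indexed by numbers, so a graph matrix needs an enumeration of the vertices. Its choice
  only conjugates the matrix by a permutation matrix and does not affect the spectrum.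
\<close>

definition vertex_list :: "'a pair_pre_digraph \<Rightarrow> 'a list" where
  "vertex_list H = (SOME vs. distinct vs \<and> set vs = pverts H)"

definition adjacency_mat :: "'a pair_pre_digraph \<Rightarrow> real mat" where
  "adjacency_mat H = (let vs = vertex_list H; n = length vs in
    mat n n (\<lambda>(i, j). if (vs ! i, vs ! j) \<in> parcs H then 1 else 0))"

text \<open>The degree of a vertex is its out-degree, as every edge contributes one outgoing arc.\<close>

definition degree_mat :: "'a pair_pre_digraph \<Rightarrow> real mat" where
  "degree_mat H = (let vs = vertex_list H; n = length vs in
    mat n n (\<lambda>(i, j). if i = j then real (out_degree (with_proj H) (vs ! i)) else 0))"

definition A_alpha :: "real \<Rightarrow> 'a pair_pre_digraph \<Rightarrow> real mat" where
  "A_alpha \<alpha> H = \<alpha> \<cdot>\<^sub>m degree_mat H + (1 - \<alpha>) \<cdot>\<^sub>m adjacency_mat H"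

text \<open>
  The library's spectral radius is defined for complex matrices as the largest modulus of an
  eigenvalue. As \<open>A_alpha \<alpha> H\<close> is symmetric and, for \<open>0 \<le> \<alpha> < 1\<close>, entrywise nonnegative, this is its
  largest eigenvalue.
\<close>

definition rho_alpha :: "real \<Rightarrow> 'a pair_pre_digraph \<Rightarrow> real" where
  "rho_alpha \<alpha> H = spectral_radius (map_mat complex_of_real (A_alpha \<alpha> H))"

end

theory Submission
  imports Defs "HOL-Analysis.Function_Topology"
begin

text \<open>
  Fix \<open>\<rho>\<close>. Maximising the energy \<open>x \<bullet> A_alpha x - \<rho> * x \<bullet> x\<close> over the vertices of a pendant path of length
  \<open>m\<close> leaves \<open>branch \<alpha> \<rho> m * (x u)\<^sup>2\<close>, so that a list \<open>xs\<close> of path lengths enters only through the sum \<open>\<Phi> \<rho> xs\<close>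
  of these numbers, and \<open>\<Phi> \<rho> a < \<Phi> \<rho> b\<close> at \<open>\<rho> = \<rho>\<^sub>\<alpha>(G(a,u))\<close> gives \<open>\<rho>\<^sub>\<alpha>(G(a,u)) < \<rho>\<^sub>\<alpha>(G(b,u))\<close>. As
  \<open>branch \<alpha> \<rho> 0 = 0\<close>, one may pad \<open>a\<close> with zeros to the length of \<open>b\<close>; only the lexicographic case is left.

  Balancing two paths always increases the spectral radius. For \<open>\<rho> > 2\<close> the sequence \<open>branch \<alpha> \<rho>\<close> is concave
  with a geometrically decaying deficit, and the bound \<open>\<Phi> \<rho> b \<le> \<rho>\<close> limits the number of branches just
  enough for the lexicographic comparison. If both spectral radii are at most 2, then \<open>G(b,u)\<close> is so
  small that balancing settles the few remaining cases.
\<close>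

section \<open>Rayleigh quotients of nonnegative symmetric kernels\<close>

text \<open>Balancing compares only lists related by majorisation, and shortlex order goes beyond
  that: (1,3,3,3) precedes (2,2,2,4), although neither is more balanced than the other. The gain
  from lengthening the first differing path must then beat the loss on all later ones. Call deficit
  the relative gap between a branch and an infinite one. One more edge multiplies a deficit by less
  than q, while the root has room for only about 1 / q branches of \<open>b\<close>. So even if r
  paths are cut down to the least possible length s + 1, their joint deficit, about r * q * e s,
  hardly exceeds the deficit e s of the one path of length s. The error terms are absorbed by the
  remaining paths of \<open>a\<close>. The threshold 2 is the supremum of the spectral radii of
  paths. Above it the recurrence along a path has a real solution t > 1 and every length is
  admissible; at 2 the deficits no longer decay geometrically, and below 2 long paths are not
  admissible.\<close>

definition kernel_form :: "'v set \<Rightarrow> ('v \<Rightarrow> 'v \<Rightarrow> real) \<Rightarrow> ('v \<Rightarrow> real) \<Rightarrow> real" where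
  "kernel_form V k x = (\<Sum>v\<in>V. \<Sum>w\<in>V. k v w * x v * x w)"

text \<open>Compactness of the unit sphere. The vertex type may be infinite, so functions are fixed
  to be 0 outside \<open>V\<close>; the sphere is then a closed subset of the compact product
  \<open>B\<close>.\<close>

lemma kernel_form_attains_max:
  fixes V :: "'v set"
  assumes fin: "finite V" and ne: "V \<noteq> {}"
  shows "\<exists>w. (\<Sum>v\<in>V. (w v)\<^sup>2) = 1 \<and>
    (\<forall>x. kernel_form V k x \<le> kernel_form V k w * (\<Sum>v\<in>V. (x v)\<^sup>2))"
proof -
  define B where "B = (PiE UNIV (\<lambda>v. if v \<in> V then {-1..1::real} else {0}))"
  define S where "S = B \<inter> {x. (\<Sum>v\<in>V. (x v)\<^sup>2) = 1}"
  have coord: "continuous_on UNIV (\<lambda>x::'v \<Rightarrow> real. x v)" for v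
    by (rule continuous_on_product_coordinates)
  have "compactin (product_topology (\<lambda>_. euclidean) UNIV) B"
    unfolding B_def by (subst compactin_PiE) (auto intro: disjI2)
  then have "compact B"
    by (simp add: euclidean_product_topology)
  moreover have "closed {x::'v \<Rightarrow> real. (\<Sum>v\<in>V. (x v)\<^sup>2) = 1}"
    by (intro closed_Collect_eq continuous_intros coord)
  ultimately have cS: "compact S"
    unfolding S_def by blast
  obtain v0 where v0: "v0 \<in> V" using ne by blast
  have "(\<lambda>v. if v = v0 then 1 else 0) \<in> S"
    using v0 fin by (auto simp: S_def B_def if_distrib[of "\<lambda>x. x\<^sup>2"] cong: if_cong)
  then have neS: "S \<noteq> {}" by blast
  have cont: "continuous_on S (kernel_form V k)"
    unfolding kernel_form_def
    by (intro continuous_intros continuous_on_subset[OF coord]) auto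
  obtain w where w: "w \<in> S" and max: "\<And>x. x \<in> S \<Longrightarrow> kernel_form V k x \<le> kernel_form V k w"
    using continuous_attains_sup[OF cS neS cont] by blast
  have "kernel_form V k x \<le> kernel_form V k w * (\<Sum>v\<in>V. (x v)\<^sup>2)" for x
  proof (cases "(\<Sum>v\<in>V. (x v)\<^sup>2) = 0")
    case True
    then have "\<forall>v\<in>V. x v = 0" using fin by (simp add: sum_nonneg_eq_0_iff)
    then show ?thesis by (simp add: kernel_form_def)
  next
    case False
    define N where "N = (\<Sum>v\<in>V. (x v)\<^sup>2)"
    have N: "N > 0" using False unfolding N_def by (simp add: less_le sum_nonneg)
    define y where "y v = (if v \<in> V then x v / sqrt N else 0)" for v
    have yN: "(\<Sum>v\<in>V. (y v)\<^sup>2) = 1"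
      using N by (simp add: y_def power_divide N_def flip: sum_divide_distrib)
    have y1: "\<bar>y v\<bar> \<le> 1" if "v \<in> V" for v
    proof -
      have "(y v)\<^sup>2 \<le> (\<Sum>v\<in>V. (y v)\<^sup>2)" by (rule member_le_sum[OF that]) (use fin in auto)
      then show ?thesis using yN abs_le_square_iff[of "y v" 1] by simp
    qed
    have "y \<in> B" unfolding B_def
    proof (rule PiE_I)
      fix v show "y v \<in> (if v \<in> V then {-1..1} else {0})"
        using y1[of v] by (cases "v \<in> V") (simp_all only: if_True if_False atLeastAtMost_iff abs_le_iff, simp_all add: y_def)
    qed simp
    with yN have "y \<in> S" by (simp add: S_def)
    then have "kernel_form V k y \<le> kernel_form V k w" by (rule max)
    moreover have "kernel_form V k y = kernel_form V k x / N"
      unfolding kernel_form_def sum_divide_distrib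
      by (intro sum.cong refl) (use N in \<open>auto simp: y_def\<close>)
    ultimately show ?thesis using N by (simp add: divide_le_eq N_def)
  qed
  then show ?thesis using w by (intro exI[of _ w]) (auto simp: S_def)
qed

text \<open>Because the kernel is nonnegative, the absolute value of a maximiser of the Rayleigh
  quotient is again a maximiser; vanishing of its first variation at each vertex is the eigenvalue
  equation.\<close>

lemma nonneg_symmetric_kernel_eigenfunction:
  assumes fin: "finite V" and ne: "V \<noteq> {}"
    and sym: "\<And>v w. v \<in> V \<Longrightarrow> w \<in> V \<Longrightarrow> k v w = k w v"
    and nn: "\<And>v w. v \<in> V \<Longrightarrow> w \<in> V \<Longrightarrow> 0 \<le> k v w"
  obtains \<mu> w where "\<And>x. kernel_form V k x \<le> \<mu> * (\<Sum>v\<in>V. (x v)\<^sup>2)"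
    and "\<And>v. 0 \<le> w v" and "\<exists>v\<in>V. 0 < w v" and "\<And>v. v \<in> V \<Longrightarrow> (\<Sum>z\<in>V. k v z * w z) = \<mu> * w v"
proof -
  obtain w0 where w0: "(\<Sum>v\<in>V. (w0 v)\<^sup>2) = 1"
    and max: "\<And>x. kernel_form V k x \<le> kernel_form V k w0 * (\<Sum>v\<in>V. (x v)\<^sup>2)"
    using kernel_form_attains_max[OF fin ne] by metis
  define \<mu> where "\<mu> = kernel_form V k w0"
  define w where "w v = \<bar>w0 v\<bar>" for v
  have wN: "(\<Sum>v\<in>V. (w v)\<^sup>2) = 1" using w0 by (simp add: w_def)
  have "\<mu> \<le> kernel_form V k w"
    unfolding \<mu>_def kernel_form_def w_def
    by (intro sum_mono) (metis abs_ge_self abs_mult abs_of_nonneg nn)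
  then have wmu: "kernel_form V k w = \<mu>" using max[of w] wN by (simp add: \<mu>_def)
  have ev: "(\<Sum>z\<in>V. k v z * w z) = \<mu> * w v" if v: "v \<in> V" for v
  proof -
    define L where "L = (\<Sum>z\<in>V. k v z * w z)"
    have expand: "kernel_form V k (\<lambda>z. w z + (if z = v then \<epsilon> else 0)) = \<mu> + 2 * \<epsilon> * L + \<epsilon>\<^sup>2 * k v v" for \<epsilon>
    proof -
      have "kernel_form V k (\<lambda>z. w z + (if z = v then \<epsilon> else 0)) =
        (\<Sum>a\<in>V. \<Sum>b\<in>V. k a b * w a * w b + (if a = v then k a b * \<epsilon> * w b else 0)
          + (if b = v then k a b * w a * \<epsilon> else 0) + (if a = v then if b = v then k a b * \<epsilon>\<^sup>2 else 0 else 0))"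
        unfolding kernel_form_def
        by (intro sum.cong refl) (auto simp: algebra_simps power2_eq_square)
      also have "\<dots> = kernel_form V k w + (\<Sum>b\<in>V. k v b * \<epsilon> * w b) + (\<Sum>a\<in>V. k a v * w a * \<epsilon>) + k v v * \<epsilon>\<^sup>2"
      proof -
        have "(\<Sum>a\<in>V. \<Sum>b\<in>V. if a = v then k a b * \<epsilon> * w b else 0) = (\<Sum>b\<in>V. k v b * \<epsilon> * w b)"
          by (subst sum.swap) (use fin v in simp)
        moreover have "(\<Sum>a\<in>V. \<Sum>b\<in>V. if a = v then if b = v then k a b * \<epsilon>\<^sup>2 else 0 else 0) = k v v * \<epsilon>\<^sup>2"
          by (subst sum.swap) (use fin v in simp)
        ultimately show ?thesis
          using fin v by (simp add: sum.distrib kernel_form_def)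
      qed
      also have "(\<Sum>a\<in>V. k a v * w a * \<epsilon>) = (\<Sum>b\<in>V. k v b * \<epsilon> * w b)"
        by (intro sum.cong refl) (use sym v in auto)
      also have "(\<Sum>b\<in>V. k v b * \<epsilon> * w b) = \<epsilon> * L"
        by (simp add: L_def sum_distrib_left algebra_simps)
      finally show ?thesis by (simp add: wmu)
    qed
    have norm: "(\<Sum>z\<in>V. (w z + (if z = v then \<epsilon> else 0))\<^sup>2) = 1 + 2 * \<epsilon> * w v + \<epsilon>\<^sup>2" for \<epsilon>
    proof -
      have "(\<Sum>z\<in>V. (w z + (if z = v then \<epsilon> else 0))\<^sup>2)
        = (\<Sum>z\<in>V. (w z)\<^sup>2 + (if z = v then 2 * \<epsilon> * w z + \<epsilon>\<^sup>2 else 0))"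
        by (intro sum.cong refl) (auto simp: power2_eq_square algebra_simps)
      then show ?thesis using fin v wN by (simp add: sum.distrib)
    qed
    \<comment> \<open>\<open>C\<close> is a positive bound for the second-order coefficient. With
      \<epsilon> = \<open>X / C\<close> in \<open>quad\<close>, the linear term would outweigh the
      quadratic one unless \<open>X = 0\<close>.\<close>
    define C where "C = \<bar>\<mu> - k v v\<bar> + 1"
    have quad: "2 * \<epsilon> * (L - \<mu> * w v) \<le> \<epsilon>\<^sup>2 * C" for \<epsilon>
    proof -
      have "\<mu> + 2 * \<epsilon> * L + \<epsilon>\<^sup>2 * k v v \<le> \<mu> * (1 + 2 * \<epsilon> * w v + \<epsilon>\<^sup>2)"
        using max[of "\<lambda>z. w z + (if z = v then \<epsilon> else 0)"] unfolding expand norm \<mu>_def[symmetric] .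
      then have "2 * \<epsilon> * (L - \<mu> * w v) \<le> \<epsilon>\<^sup>2 * (\<mu> - k v v)" by (simp add: algebra_simps)
      also have "\<dots> \<le> \<epsilon>\<^sup>2 * C" by (intro mult_left_mono) (auto simp: C_def)
      finally show ?thesis .
    qed
    have C: "C > 0" by (simp add: C_def)
    define X where "X = L - \<mu> * w v"
    have "2 * (X\<^sup>2 / C) \<le> X\<^sup>2 / C"
      using quad[of "X / C"] C by (simp add: X_def[symmetric] power2_eq_square)
    then have "X\<^sup>2 / C \<le> 0" by simp
    then have "X = 0" using C by (simp add: divide_le_0_iff)
    then show ?thesis by (simp add: L_def X_def)
  qed
  have "\<exists>v\<in>V. 0 < w v"
  proof (rule ccontr)
    assume "\<not> ?thesis"
    then have "\<forall>v\<in>V. w v = 0" by (auto simp: w_def)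
    then show False using wN by simp
  qed
  with that[of \<mu> w] ev max show ?thesis by (auto simp: \<mu>_def w_def)
qed

section \<open>The quadratic form of a graph\<close>

abbreviation nbrs :: "'v pair_pre_digraph \<Rightarrow> 'v \<Rightarrow> 'v set" where
  "nbrs H v \<equiv> {z. (v, z) \<in> parcs H}"

text \<open>The quadratic form of \<open>A_alpha\<close> without an enumeration of the vertices: a
  vertex is the tail of as many arcs as its degree, so the squares add up to the degree
  part.\<close>

definition alpha_form :: "real \<Rightarrow> 'v pair_pre_digraph \<Rightarrow> ('v \<Rightarrow> real) \<Rightarrow> real" where
  "alpha_form \<alpha> H x = (\<Sum>(v, z)\<in>parcs H. \<alpha> * (x v)\<^sup>2 + (1 - \<alpha>) * x v * x z)"

definition alpha_kernel :: "real \<Rightarrow> 'v pair_pre_digraph \<Rightarrow> 'v \<Rightarrow> 'v \<Rightarrow> real" where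
  "alpha_kernel \<alpha> H v z =
    \<alpha> * (if v = z then real (card (nbrs H v)) else 0) + (1 - \<alpha>) * (if (v, z) \<in> parcs H then 1 else 0)"

context
  fixes H :: "'v pair_pre_digraph" and \<alpha> :: real
  assumes H: "pair_graph H"
begin

interpretation pair_graph H by (rule H)

lemma finite_nbrs: "finite (nbrs H v)"
  and nbrs_subset: "nbrs H v \<subseteq> pverts H"
proof -
  show "nbrs H v \<subseteq> pverts H" using in_arcsD2 by blast
  then show "finite (nbrs H v)" using pair_finite_verts finite_subset by blast
qed

lemma sum_alpha_kernel:
  assumes v: "v \<in> pverts H"
  shows "(\<Sum>z\<in>pverts H. alpha_kernel \<alpha> H v z * x z) = (\<Sum>z\<in>nbrs H v. \<alpha> * x v + (1 - \<alpha>) * x z)"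
proof -
  have "(\<Sum>z\<in>pverts H. alpha_kernel \<alpha> H v z * x z) =
      (\<Sum>z\<in>pverts H. if v = z then \<alpha> * real (card (nbrs H v)) * x z else 0)
      + (\<Sum>z\<in>pverts H. if z \<in> nbrs H v then (1 - \<alpha>) * x z else 0)"
    unfolding sum.distrib[symmetric] alpha_kernel_def
    by (intro sum.cong refl) (simp add: algebra_simps)
  also have "(\<Sum>z\<in>pverts H. if z \<in> nbrs H v then (1 - \<alpha>) * x z else 0) = (\<Sum>z\<in>nbrs H v. (1 - \<alpha>) * x z)"
    using nbrs_subset by (subst sum.inter_restrict[symmetric]) (auto intro: sum.cong)
  finally show ?thesis using v by (simp add: sum.distrib)
qed

lemma alpha_form_conv:
  "alpha_form \<alpha> H x = (\<Sum>v\<in>pverts H. x v * (\<Sum>z\<in>nbrs H v. \<alpha> * x v + (1 - \<alpha>) * x z))"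
proof -
  have arcs: "parcs H = Sigma (pverts H) (nbrs H)"
    using in_arcsD1 by auto
  have "(\<Sum>v\<in>pverts H. x v * (\<Sum>z\<in>nbrs H v. \<alpha> * x v + (1 - \<alpha>) * x z))
      = (\<Sum>v\<in>pverts H. \<Sum>z\<in>nbrs H v. \<alpha> * (x v)\<^sup>2 + (1 - \<alpha>) * x v * x z)"
    unfolding sum_distrib_left
    by (intro sum.cong refl) (simp add: power2_eq_square algebra_simps)
  also have "\<dots> = alpha_form \<alpha> H x"
    unfolding alpha_form_def by (subst (2) arcs, subst sum.Sigma) (auto simp: finite_nbrs)
  finally show ?thesis by simp
qed

lemma alpha_form_eigenfunction:
  assumes "\<And>v. v \<in> pverts H \<Longrightarrow> (\<Sum>z\<in>nbrs H v. \<alpha> * x v + (1 - \<alpha>) * x z) = \<rho> * x v"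
  shows "alpha_form \<alpha> H x = \<rho> * (\<Sum>v\<in>pverts H. (x v)\<^sup>2)"
proof -
  have "alpha_form \<alpha> H x = (\<Sum>v\<in>pverts H. x v * (\<rho> * x v))"
    unfolding alpha_form_conv by (intro sum.cong refl) (simp only: assms)
  then show ?thesis by (simp add: sum_distrib_left power2_eq_square mult_ac)
qed

lemma kernel_form_alpha_kernel: "kernel_form (pverts H) (alpha_kernel \<alpha> H) x = alpha_form \<alpha> H x"
proof -
  have "kernel_form (pverts H) (alpha_kernel \<alpha> H) x
      = (\<Sum>v\<in>pverts H. x v * (\<Sum>z\<in>pverts H. alpha_kernel \<alpha> H v z * x z))"
    unfolding kernel_form_def sum_distrib_left by (intro sum.cong refl) simp
  then show ?thesis unfolding alpha_form_conv by (simp add: sum_alpha_kernel)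
qed

lemma vertex_list: "distinct (vertex_list H)" "set (vertex_list H) = pverts H"
proof -
  have "\<exists>vs. distinct vs \<and> set vs = pverts H"
    using finite_distinct_list[OF pair_finite_verts] by blast
  from someI_ex[OF this] show "distinct (vertex_list H)" "set (vertex_list H) = pverts H"
    unfolding vertex_list_def by blast+
qed

lemma out_degree_conv: "out_degree (with_proj H) v = card (nbrs H v)"
proof -
  have "out_arcs (with_proj H) v = Pair v ` nbrs H v"
    by (auto simp: out_arcs_def)
  then show ?thesis by (simp add: out_degree_def card_image inj_on_def)
qed

lemma A_alpha_conv:
  "A_alpha \<alpha> H = mat (length (vertex_list H)) (length (vertex_list H))
    (\<lambda>(i, j). alpha_kernel \<alpha> H (vertex_list H ! i) (vertex_list H ! j))"
  unfolding A_alpha_def degree_mat_def adjacency_mat_def Let_def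
  by (rule eq_matI) (auto simp: alpha_kernel_def out_degree_conv nth_eq_iff_index_eq vertex_list(1))

text \<open>The passage from the complex matrix to real functions on the vertices. The maximum \<mu>
  of the Rayleigh quotient is an eigenvalue, and the moduli of the entries of any complex
  eigenvector form a test function showing that no eigenvalue exceeds \<mu> in modulus.\<close>

lemma rho_alpha_rayleigh:
  assumes ne: "pverts H \<noteq> {}" and \<alpha>: "0 \<le> \<alpha>" "\<alpha> \<le> 1"
  obtains w where "\<And>x. alpha_form \<alpha> H x \<le> rho_alpha \<alpha> H * (\<Sum>v\<in>pverts H. (x v)\<^sup>2)"
    and "\<And>v. 0 \<le> w v" and "\<exists>v\<in>pverts H. 0 < w v"
    and "\<And>v. v \<in> pverts H \<Longrightarrow> (\<Sum>z\<in>nbrs H v. \<alpha> * w v + (1 - \<alpha>) * w z) = rho_alpha \<alpha> H * w v"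
proof -
  let ?V = "pverts H" and ?k = "alpha_kernel \<alpha> H"
  have sym: "?k v z = ?k z v" if "v \<in> ?V" "z \<in> ?V" for v z
    using pair_sym_arcs by (auto simp: alpha_kernel_def symmetric_def sym_def)
  have nn: "0 \<le> ?k v z" for v z using \<alpha> by (simp add: alpha_kernel_def)
  obtain \<mu> w where max: "\<And>x. kernel_form ?V ?k x \<le> \<mu> * (\<Sum>v\<in>?V. (x v)\<^sup>2)"
    and w0: "\<And>v. 0 \<le> w v" and w1: "\<exists>v\<in>?V. 0 < w v"
    and ev: "\<And>v. v \<in> ?V \<Longrightarrow> (\<Sum>z\<in>?V. ?k v z * w z) = \<mu> * w v"
    by (rule nonneg_symmetric_kernel_eigenfunction[OF pair_finite_verts ne sym nn]) blast+
  define vs where "vs = vertex_list H"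
  define n where "n = length vs"
  have vs: "distinct vs" "set vs = ?V" using vertex_list by (simp_all add: vs_def)
  define M where "M = map_mat complex_of_real (A_alpha \<alpha> H)"
  have M: "M \<in> carrier_mat n n"
    by (simp add: M_def A_alpha_conv n_def vs_def)
  have bij: "bij_betw (\<lambda>i. vs ! i) {0..<n} ?V"
    by (rule bij_betw_nth) (simp_all add: vs n_def atLeast0LessThan)
  have vsV: "vs ! i \<in> ?V" if "i < n" for i
    using nth_mem[of i vs] that unfolding n_def vs(2) by blast
  have M_nth: "M $$ (i, j) = complex_of_real (?k (vs ! i) (vs ! j))" if "i < n" "j < n" for i j
    using that by (simp add: M_def A_alpha_conv vs_def n_def)
  have mult: "(M *\<^sub>v y) $ i = (\<Sum>j\<in>{0..<n}. complex_of_real (?k (vs ! i) (vs ! j)) * y $ j)"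
    if "y \<in> carrier_vec n" "i < n" for y i
    using that M by (auto simp: scalar_prod_def M_nth intro!: sum.cong)
  have n0: "n \<noteq> 0" using ne vs(2) by (auto simp: n_def)
  have "eigenvalue M (complex_of_real \<mu>)"
  proof -
    define y where "y = vec n (\<lambda>i. complex_of_real (w (vs ! i)))"
    obtain v where v: "v \<in> ?V" "0 < w v" using w1 by blast
    then obtain i where i: "i < n" "vs ! i = v"
      using vs(2) by (metis in_set_conv_nth n_def)
    have "y \<noteq> 0\<^sub>v n"
    proof
      assume "y = 0\<^sub>v n"
      then have "y $ i = 0" using i by simp
      then show False using i v by (simp add: y_def)
    qed
    moreover have "M *\<^sub>v y = complex_of_real \<mu> \<cdot>\<^sub>v y"
    proof (rule eq_vecI)
      fix i assume "i < dim_vec (complex_of_real \<mu> \<cdot>\<^sub>v y)"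
      then have i: "i < n" by (simp add: y_def)
      have "(M *\<^sub>v y) $ i = complex_of_real (\<Sum>j\<in>{0..<n}. ?k (vs ! i) (vs ! j) * w (vs ! j))"
        using i by (subst mult) (auto simp: y_def)
      also have "(\<Sum>j\<in>{0..<n}. ?k (vs ! i) (vs ! j) * w (vs ! j)) = (\<Sum>z\<in>?V. ?k (vs ! i) z * w z)"
        using sum.reindex_bij_betw[OF bij, of "\<lambda>z. ?k (vs ! i) z * w z"] by simp
      finally show "(M *\<^sub>v y) $ i = (complex_of_real \<mu> \<cdot>\<^sub>v y) $ i"
        using i vsV by (simp add: ev y_def)
    qed (use M in \<open>simp add: y_def\<close>)
    ultimately show ?thesis
      using M by (auto simp: eigenvalue_def eigenvector_def y_def intro!: exI[of _ y])
  qed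
  then have le: "\<mu> \<le> spectral_radius M"
    using spectral_radius_mem_max(2)[OF M n0[THEN neq0_conv[THEN iffD1]], of "norm (complex_of_real \<mu>)"]
    by (simp add: spectrum_def image_iff) (metis abs_ge_self norm_of_real order_trans)
  have "norm z \<le> \<mu>" if z: "eigenvalue M z" for z
  proof -
    obtain y where y: "y \<in> carrier_vec n" "y \<noteq> 0\<^sub>v n" "M *\<^sub>v y = z \<cdot>\<^sub>v y"
      using z M by (auto simp: eigenvalue_def eigenvector_def)
    define idx where "idx = the_inv_into {0..<n} (\<lambda>i. vs ! i)"
    define x where "x v = norm (y $ idx v)" for v
    have idx: "idx (vs ! i) = i" if "i < n" for i
      using that bij unfolding idx_def by (intro the_inv_into_f_f) (auto simp: bij_betw_def)
    have row: "norm z * x (vs ! i) \<le> (\<Sum>j\<in>{0..<n}. ?k (vs ! i) (vs ! j) * x (vs ! j))" if i: "i < n" for i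
    proof -
      have "norm z * x (vs ! i) = norm ((M *\<^sub>v y) $ i)"
        using i y(1) by (simp add: y(3) x_def idx norm_mult)
      also have "\<dots> \<le> (\<Sum>j\<in>{0..<n}. norm (complex_of_real (?k (vs ! i) (vs ! j)) * y $ j))"
        unfolding mult[OF y(1) i] by (rule norm_sum)
      also have "\<dots> = (\<Sum>j\<in>{0..<n}. ?k (vs ! i) (vs ! j) * x (vs ! j))"
        by (intro sum.cong refl) (simp add: norm_mult nn x_def idx)
      finally show ?thesis .
    qed
    have row': "norm z * x v \<le> (\<Sum>b\<in>?V. ?k v b * x b)" if v: "v \<in> ?V" for v
    proof -
      obtain i where i: "i < n" "v = vs ! i"
        using v vertex_list(2) by (metis in_set_conv_nth n_def vs_def)
      show ?thesis
        using row[OF i(1)] sum.reindex_bij_betw[OF bij, of "\<lambda>b. ?k v b * x b"] i by simp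
    qed
    have "norm z * (\<Sum>v\<in>?V. (x v)\<^sup>2) = (\<Sum>v\<in>?V. x v * (norm z * x v))"
      by (simp add: sum_distrib_left power2_eq_square mult_ac)
    also have "\<dots> \<le> (\<Sum>v\<in>?V. x v * (\<Sum>b\<in>?V. ?k v b * x b))"
      by (intro sum_mono mult_left_mono row') (auto simp: x_def)
    also have "\<dots> = kernel_form ?V ?k x"
      by (simp add: kernel_form_def sum_distrib_left mult_ac)
    also have "\<dots> \<le> \<mu> * (\<Sum>v\<in>?V. (x v)\<^sup>2)" by (rule max)
    finally have *: "norm z * (\<Sum>v\<in>?V. (x v)\<^sup>2) \<le> \<mu> * (\<Sum>v\<in>?V. (x v)\<^sup>2)" .
    obtain i where i: "i < n" "y $ i \<noteq> 0"
      using y(1,2) by (metis carrier_vecD eq_vecI index_zero_vec(1) index_zero_vec(2))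
    have "0 < (\<Sum>v\<in>?V. (x v)\<^sup>2)"
      by (rule sum_pos2[OF pair_finite_verts vsV[OF i(1)]]) (use i in \<open>auto simp: x_def idx\<close>)
    with * show ?thesis by simp
  qed
  then have "spectral_radius M \<le> \<mu>"
    using spectral_radius_mem_max(1)[OF M n0[THEN neq0_conv[THEN iffD1]]] by (auto simp: spectrum_def)
  with le have rho: "rho_alpha \<alpha> H = \<mu>" by (simp add: rho_alpha_def M_def)
  show ?thesis
  proof (rule that[of w])
    show "alpha_form \<alpha> H x \<le> rho_alpha \<alpha> H * (\<Sum>v\<in>pverts H. (x v)\<^sup>2)" for x
      using max[of x] by (simp add: rho kernel_form_alpha_kernel)
    show "(\<Sum>z\<in>nbrs H v. \<alpha> * w v + (1 - \<alpha>) * w z) = rho_alpha \<alpha> H * w v" if "v \<in> pverts H" for v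
      using ev[OF that] sum_alpha_kernel[OF that] by (simp add: rho)
  qed (use w0 w1 in auto)
qed

end

section \<open>Branch values\<close>

text \<open>With a branch of length \<open>m\<close> hanging at the neighbour of the root, the
  energy is a quadratic in the value at that neighbour, with leading coefficient minus the
  denominator of the recurrence. Its maximum gives the right-hand side.\<close>

primrec branch :: "real \<Rightarrow> real \<Rightarrow> nat \<Rightarrow> real" where
  "branch \<alpha> \<rho> 0 = 0"
| "branch \<alpha> \<rho> (Suc m) = \<alpha> + (1 - \<alpha>)\<^sup>2 / (\<rho> - \<alpha> - branch \<alpha> \<rho> m)"

text \<open>All denominators met in computing \<open>branch \<alpha> \<rho> m\<close> are positive,
  so each of the successive maximisations is over a concave quadratic.\<close>

definition admissible :: "real \<Rightarrow> real \<Rightarrow> nat \<Rightarrow> bool" where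
  "admissible \<alpha> \<rho> m \<longleftrightarrow> (\<forall>k<m. branch \<alpha> \<rho> k < \<rho> - \<alpha>)"

lemma admissible_mono: "admissible \<alpha> \<rho> m \<Longrightarrow> k \<le> m \<Longrightarrow> admissible \<alpha> \<rho> k"
  by (auto simp: admissible_def)

lemma admissible_0 [simp]: "admissible \<alpha> \<rho> 0"
  by (simp add: admissible_def)

lemma admissible_Suc: "admissible \<alpha> \<rho> (Suc m) \<longleftrightarrow> admissible \<alpha> \<rho> m \<and> branch \<alpha> \<rho> m < \<rho> - \<alpha>"
  by (auto simp: admissible_def less_Suc_eq)

context
  fixes \<alpha> \<rho> :: real
  assumes \<alpha>: "0 \<le> \<alpha>" "\<alpha> < 1"
begin

private abbreviation "F \<equiv> branch \<alpha> \<rho>"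
private abbreviation "D m \<equiv> \<rho> - \<alpha> - F m"

lemma branch_Suc_less: "admissible \<alpha> \<rho> (Suc m) \<Longrightarrow> F m < F (Suc m)"
proof (induction m)
  case 0
  then have "0 < \<rho> - \<alpha>" by (simp add: admissible_def)
  then have "0 < (1 - \<alpha>)\<^sup>2 / (\<rho> - \<alpha>)" using \<alpha> by simp
  then show ?case using \<alpha> by simp
next
  case (Suc m)
  then have IH: "F m < F (Suc m)" and D: "0 < D (Suc m)" by (auto simp: admissible_Suc)
  have "(1 - \<alpha>)\<^sup>2 / D m < (1 - \<alpha>)\<^sup>2 / D (Suc m)"
    using IH D \<alpha> by (intro divide_strict_left_mono mult_pos_pos) auto
  then show ?case by simp
qed

lemma branch_pos: "admissible \<alpha> \<rho> m \<Longrightarrow> 0 < m \<Longrightarrow> 0 < F m"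
proof (induction m)
  case (Suc m)
  then have "F m < F (Suc m)" by (intro branch_Suc_less)
  moreover have "0 \<le> F m" using Suc by (cases "m = 0") (auto simp: admissible_Suc)
  ultimately show ?case by simp
qed simp

lemma branch_nonneg: "admissible \<alpha> \<rho> m \<Longrightarrow> 0 \<le> F m"
  using branch_pos[of m] by (cases "m = 0") auto

text \<open>Take an edge with branches of lengths \<open>x\<close> and \<open>z\<close> at its two
  ends. After elimination of the branches a binary quadratic form remains on the edge; the
  conclusion is the positivity of its determinant.\<close>

lemma gap_mult_gt:
  assumes "admissible \<alpha> \<rho> (Suc z)" and "F x + F (Suc z) < \<rho>"
  shows "(1 - \<alpha>)\<^sup>2 < D x * D z"
proof -
  have "0 < D z" using assms(1) by (simp add: admissible_Suc)
  moreover have "(1 - \<alpha>)\<^sup>2 / D z < D x" using assms(2) by simp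
  ultimately show ?thesis by (simp add: field_simps)
qed

text \<open>The determinant condition is symmetric in the two ends of the edge and can therefore be
  read from either; this moves the root by one edge towards the middle.\<close>

lemma branch_sum_less:
  assumes "admissible \<alpha> \<rho> (Suc z)" and "F x + F (Suc z) < \<rho>" and "x \<le> z"
  shows "F (Suc x) + F z < \<rho>"
proof -
  have "0 < D x" using assms(1,3) by (simp add: admissible_def)
  then have "(1 - \<alpha>)\<^sup>2 / D x < D z"
    using gap_mult_gt[OF assms(1,2)] by (simp add: field_simps)
  then show ?thesis by simp
qed

lemma branch_increment_Suc:
  assumes "admissible \<alpha> \<rho> (Suc (Suc m))"
  shows "F (Suc (Suc m)) - F (Suc m) = (1 - \<alpha>)\<^sup>2 * (F (Suc m) - F m) / (D (Suc m) * D m)"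
proof -
  have pos: "0 < D m" "0 < D (Suc m)" using assms by (auto simp: admissible_Suc)
  have "F (Suc (Suc m)) - F (Suc m) = (1 - \<alpha>)\<^sup>2 / D (Suc m) - (1 - \<alpha>)\<^sup>2 / D m"
    by simp
  also have "\<dots> = (1 - \<alpha>)\<^sup>2 * (D m - D (Suc m)) / (D (Suc m) * D m)"
    using pos by (simp only: diff_frac_eq) (simp add: algebra_simps)
  finally show ?thesis by simp
qed

text \<open>The recurrence multiplies increments by (1 - \<alpha>)^2 over a product of two gaps.
  Tracing both increments towards the middle, the gaps can be paired across the ends as
  \<open>D x * D (Suc z)\<close> and \<open>D (Suc x) * D z\<close>, and each pair exceeds (1 -
  \<alpha>)^2 because the hypothesis persists as the ends move inwards. Thus the argument also
  covers \<rho> <= 2.\<close>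

lemma branch_increment_less:
  assumes "admissible \<alpha> \<rho> (Suc (x + k))" and "F x + F (Suc (x + k)) < \<rho>" and "0 < k"
  shows "F (Suc (x + k)) - F (x + k) < F (Suc x) - F x"
  using assms
proof (induction k arbitrary: x rule: less_induct)
  case (less k)
  let ?b = "(1 - \<alpha>)\<^sup>2" and ?d = "\<lambda>m. F (Suc m) - F m"
  obtain z where z: "x + k = Suc z" "x \<le> z" using less.prems(3) by (cases "x + k") auto
  have adm: "admissible \<alpha> \<rho> (Suc (Suc z))" using less.prems(1) z by simp
  have b: "0 < ?b" using \<alpha> by simp
  have D: "0 < D m" if "m \<le> Suc z" for m using adm that by (simp add: admissible_def)
  have inc: "0 < ?d x"
    using branch_Suc_less[of x] admissible_mono[OF less.prems(1), of "Suc x"] by simp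
  have g1: "?b < D x * D (Suc z)"
    using gap_mult_gt[of "Suc z" x] less.prems(1,2) z by simp
  have sum1: "F (Suc x) + F (Suc z) < \<rho>"
    using branch_sum_less[of "Suc z" x] less.prems(1,2) z by simp
  then have g2: "?b < D (Suc x) * D z"
    using gap_mult_gt[of z "Suc x"] adm by (simp add: admissible_Suc)
  have dz: "?d (Suc z) = ?b * ?d z / (D (Suc z) * D z)"
    by (rule branch_increment_Suc[OF adm])
  have goal: "?d (Suc z) < ?d x"
  proof (cases "k = 1")
    case True
    then have "z = x" using z by simp
    then have "?d (Suc z) = ?d x * (?b / (D x * D (Suc z)))" using dz by (simp add: mult_ac)
    also have "\<dots> < ?d x * 1"
      by (rule mult_strict_left_mono[OF _ inc])
        (simp only: divide_less_eq_1_pos[OF order.strict_trans[OF b g1]] g1)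
    finally show ?thesis by simp
  next
    case False
    then have k2: "2 \<le> k" using less.prems(3) by simp
    \<comment> \<open>Both ends have moved by one edge, so the distance drops by 2; for
      \<open>k = 2\<close> the two increments coincide, hence only a weak inequality.\<close>
    have le: "?d z \<le> ?d (Suc x)"
    proof (cases "k = 2")
      case True
      then show ?thesis using z by simp
    next
      case False
      then have "z = Suc x + (k - 2)" "k - 2 < k" "0 < k - 2" using z k2 by auto
      then show ?thesis
        using less.IH[of "k - 2" "Suc x"] adm sum1 by (simp add: admissible_Suc)
    qed
    have dx: "?d (Suc x) = ?b * ?d x / (D (Suc x) * D x)"
      by (rule branch_increment_Suc, rule admissible_mono[OF adm]) (use z k2 in simp)
    have pos: "0 < D x" "0 < D (Suc x)" "0 < D z" "0 < D (Suc z)"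
      using D[of x] D[of "Suc x"] D[of z] D[of "Suc z"] z k2 by (simp_all only: le_SucI order.refl)
    have "?d (Suc z) \<le> ?b * ?d (Suc x) / (D (Suc z) * D z)"
      unfolding dz using le b pos by (intro divide_right_mono mult_left_mono) auto
    also have "\<dots> = ?d x * (?b * ?b / ((D x * D (Suc z)) * (D (Suc x) * D z)))"
      unfolding dx by (simp add: mult_ac)
    also have "\<dots> < ?d x * 1"
    proof (rule mult_strict_left_mono[OF _ inc])
      have "?b * ?b < (D x * D (Suc z)) * (D (Suc x) * D z)"
        by (rule mult_strict_mono[OF g1 g2 mult_pos_pos[OF pos(1,4)] less_imp_le[OF b]])
      then show "?b * ?b / ((D x * D (Suc z)) * (D (Suc x) * D z)) < 1"
        using pos by (simp add: divide_less_eq)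
    qed
    finally show ?thesis by simp
  qed
  then show ?case using z by simp
qed

lemma branch_smoothing:
  assumes "admissible \<alpha> \<rho> y" and "F x + F y < \<rho>" and "x + 2 \<le> y"
  shows "F x + F y < F (x + 1) + F (y - 1)"
proof -
  obtain k where k: "y = Suc (x + k)" "0 < k"
    using assms(3) by (intro that[of "y - Suc x"]) auto
  show ?thesis using branch_increment_less[of x k] assms k by simp
qed

text \<open>
  In the proof, \<open>t > 1\<close> solves \<open>\<rho> = 2 * \<alpha> + (1 - \<alpha>) * (t + 1 / t)\<close>, the characteristic equation of the
  recurrence along a path, \<open>q = 1 / t\<^sup>2\<close>, and \<open>L\<close> is the value \<^term>\<open>branch \<alpha> \<rho>\<close> at an infinite path.
\<close>

lemma branch_deficit:
  assumes \<rho>: "2 < \<rho>"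
  obtains L q c :: real and e :: "nat \<Rightarrow> real" where
    "0 < L" "0 < q" "q < 1" "1 \<le> c" "e 0 = 1" "\<And>m. e (Suc m) = q * e m / (1 + c * q * e m)"
    "\<And>m. F m = L * (1 - e m)" "\<And>m. admissible \<alpha> \<rho> m" "\<rho> \<le> L * (1 + 1 / q)"
proof -
  define b where "b = 1 - \<alpha>"
  have b: "0 < b" "\<alpha> = 1 - b" using \<alpha> by (simp_all add: b_def)
  define S where "S = (\<rho> - 2 * \<alpha>) / b"
  have S: "2 < S" using \<rho> b by (simp add: S_def less_divide_eq)
  define t where "t = (S + sqrt (S\<^sup>2 - 4)) / 2"
  have "4 < S\<^sup>2" using power_strict_mono[of 2 S 2] S by simp
  then have sq: "(sqrt (S\<^sup>2 - 4))\<^sup>2 = S\<^sup>2 - 4" "0 < sqrt (S\<^sup>2 - 4)" by simp_all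
  have "2 < S + sqrt (S\<^sup>2 - 4)" using S sq(2) by linarith
  then have t1: "1 < t" by (simp add: t_def)
  have "t\<^sup>2 + 1 = S * t"
    using sq(1) by (simp add: t_def power2_eq_square field_simps)
  then have St: "S = t + 1 / t" using t1 by (simp add: field_simps power2_eq_square)
  then have lam: "\<rho> = 2 * \<alpha> + b * t + b / t" using b by (simp add: S_def field_simps)
  define L where "L = \<alpha> + b / t"
  have L: "0 < L" using \<alpha> b t1 by (simp add: L_def add_nonneg_pos)
  define q where "q = 1 / t\<^sup>2"
  have q: "0 < q" "q < 1" using t1 by (auto simp: q_def power2_eq_square less_1_mult)
  \<comment> \<open>The deficit recurrence is the Moebius map of \<open>branch\<close> recentred at
    its fixed point \<open>L\<close>. The constant \<open>c\<close> is 1 + \<alpha> * t / b, hence 1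
    for \<alpha> = 0.\<close>
  define c where "c = L * t / b"
  have c: "1 \<le> c" using \<alpha> b t1 by (simp add: c_def L_def field_simps)
  define e where "e m = 1 - F m / L" for m
  have F: "F m = L * (1 - e m)" for m using L by (simp add: e_def)
  have gap: "D m = b * t + L * e m" for m
    using L by (simp add: F algebra_simps) (simp add: lam L_def)
  have eS: "e (Suc m) = q * e m / (1 + c * q * e m)" if "0 < e m" for m
  proof -
    have pos: "0 < b * t + L * e m" using that b t1 L by (simp add: add_pos_pos)
    have "L * e (Suc m) = L - F (Suc m)" unfolding F by (simp add: right_diff_distrib)
    also have "\<dots> = b / t - b\<^sup>2 / (b * t + L * e m)"
      using gap[of m] by (simp add: L_def b_def)
    also have "\<dots> = b * (L * e m) / (t * (b * t + L * e m))"
      using pos t1 by (simp add: diff_frac_eq power2_eq_square) (simp add: algebra_simps)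
    also have "\<dots> = L * (b * e m / (t * (b * t + L * e m)))" by simp
    finally have "e (Suc m) = b * e m / (t * (b * t + L * e m))" using mult_left_cancel[of L] L by (metis less_irrefl)
    moreover have "1 + c * q * e m = (b * t + L * e m) / (b * t)"
      using b t1 by (simp add: q_def c_def power2_eq_square field_simps)
    ultimately show ?thesis using pos b t1 by (simp add: q_def power2_eq_square)
  qed
  have epos: "0 < e m" for m
  proof (induction m)
    case (Suc m)
    then show ?case using eS[OF Suc] q c by (simp add: add_pos_pos)
  qed (simp add: e_def)
  have "admissible \<alpha> \<rho> m" for m
  proof -
    have "0 < D k" for k unfolding gap using epos[of k] b t1 L by (simp add: add_pos_pos)
    then show ?thesis by (simp add: admissible_def)
  qed
  \<comment> \<open>The difference of the two sides is \<alpha> * (t^2 - 1).\<close>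
  moreover have "\<rho> \<le> L * (1 + 1 / q)"
  proof -
    have "\<alpha> * 1 \<le> \<alpha> * t\<^sup>2" using \<alpha> t1 by (intro mult_left_mono) (auto simp: power2_eq_square less_1_mult less_imp_le)
    then show ?thesis using t1 by (simp add: lam L_def q_def algebra_simps power2_eq_square)
  qed
  moreover have "e 0 = 1" by (simp add: e_def)
  ultimately show ?thesis using that[of L q c e] L q c eS epos F by blast
qed

end

section \<open>Convexity of the deficit sequence\<close>

context
  fixes e :: "nat \<Rightarrow> real" and q c :: real
  assumes q: "0 < q" "q < 1" and c: "1 \<le> c"
    and e0: "e 0 = 1" and eS: "\<And>m. e (Suc m) = q * e m / (1 + c * q * e m)"
begin

lemma deficit_pos: "0 < e m"
proof (induction m)
  case (Suc m)
  then show ?case unfolding eS using q c by (simp add: add_pos_pos)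
qed (simp add: e0)

lemma deficit_Suc_less: "e (Suc m) < e m"
proof -
  have "0 < c * q * e m" using q c deficit_pos[of m] by simp
  then have "e (Suc m) \<le> q * e m"
    unfolding eS using q deficit_pos[of m] divide_left_mono[of 1 "1 + c * q * e m" "q * e m"] by simp
  also have "\<dots> < 1 * e m" using q deficit_pos[of m] by (intro mult_strict_right_mono)
  finally show ?thesis by simp
qed

lemma deficit_antimono: "m \<le> n \<Longrightarrow> e n \<le> e m"
  by (rule lift_Suc_antimono_le[of e]) (simp_all add: deficit_Suc_less less_imp_le)

lemma deficit_le_1: "e m \<le> 1"
  using deficit_antimono[of 0 m] e0 by simp

text \<open>The drop \<open>g\<close> is an increasing function of the deficit, because chords of
  the recurrence map have slope q / (X * Y) < 1; since deficits decrease, so do their drops.\<close>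

lemma deficit_drop_Suc_less: "e (Suc m) - e (Suc (Suc m)) < e m - e (Suc m)"
proof -
  define g where "g x = x - q * x / (1 + c * q * x)" for x
  have *: "g x < g y" if "0 < x" "x < y" for x y
  proof -
    let ?X = "1 + c * q * x" and ?Y = "1 + c * q * y"
    have cq: "0 < c * q" using q c by simp
    have X: "1 < ?X" "1 < ?Y" using that mult_pos_pos[OF cq, of x] mult_pos_pos[OF cq, of y] by auto
    have "q * y / ?Y - q * x / ?X = (y - x) * (q / (?X * ?Y))"
      using X by (simp add: diff_frac_eq) (simp add: algebra_simps)
    also have "q / (?X * ?Y) < 1"
      using less_1_mult[OF X] q X by (subst divide_less_eq) auto
    then have "(y - x) * (q / (?X * ?Y)) < (y - x) * 1" using that by (intro mult_strict_left_mono) auto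
    finally show ?thesis by (simp add: g_def)
  qed
  show ?thesis
    using *[OF deficit_pos deficit_Suc_less, of m] by (simp only: g_def eS[symmetric])
qed

lemma deficit_drop_antimono: "m \<le> n \<Longrightarrow> e n - e (Suc n) \<le> e m - e (Suc m)"
  by (rule lift_Suc_antimono_le[of "\<lambda>m. e m - e (Suc m)"]) (simp_all add: deficit_drop_Suc_less less_imp_le)

lemma deficit_shift: "m \<le> n \<Longrightarrow> e n - e (n + j) \<le> e m - e (m + j)"
proof (induction j)
  case (Suc j)
  then show ?case using deficit_drop_antimono[of "m + j" "n + j"] by simp
qed simp

lemma deficit_drop_le: "m \<le> n \<Longrightarrow> e n - e (n + k) \<le> real k * (e m - e (Suc m))"
proof (induction k)
  case (Suc k)
  then show ?case using deficit_drop_antimono[of m "n + k"] by (simp add: algebra_simps)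
qed simp

text \<open>The left side is the line through the points of \<open>e\<close> at \<open>s\<close> and
  \<open>Suc s\<close>; a convex sequence lies above such a line at all other integers.\<close>

lemma deficit_tangent:
  "e (Suc s) + (e s - e (Suc s)) * (real (Suc s) - real x) \<le> e x"
proof (cases "x \<le> s")
  case True
  have "real k * (e s - e (Suc s)) \<le> e (s - k) - e s" if "k \<le> s" for k
    using that
  proof (induction k)
    case (Suc k)
    then have "Suc (s - Suc k) = s - k" by simp
    then show ?case using Suc deficit_drop_antimono[of "s - Suc k" s] by (simp add: algebra_simps)
  qed simp
  from this[of "s - x"] True show ?thesis by (simp add: algebra_simps of_nat_diff)
next
  case False
  then obtain k where "x = Suc s + k" using less_iff_Suc_add[of s x] by auto
  then show ?thesis
    using deficit_drop_le[of s "Suc s" k] by (simp add: algebra_simps)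
qed

text \<open>By convexity the sum is largest when the whole excess over \<open>m\<close> sits in one
  entry; the entries are merged one by one.\<close>

lemma deficit_merge:
  "d \<noteq> [] \<Longrightarrow> (\<Sum>x\<leftarrow>d. e (m + x)) \<le> real (length d - 1) * e m + e (m + sum_list d)"
proof (induction d)
  case (Cons x d)
  show ?case
  proof (cases "d = []")
    case False
    have "e (m + x) + e (m + sum_list d) \<le> e m + e (m + (x + sum_list d))"
      using deficit_shift[of m "m + sum_list d" x] by (simp add: add_ac)
    moreover have "real (length (x # d) - 1) * e m = real (length d - 1) * e m + e m"
      using False by (cases d) (simp_all add: distrib_right)
    ultimately show ?thesis using Cons.IH[OF False] by simp
  qed simp
qed simp

text \<open>
  Convexity reduces \<open>ys\<close> to copies of \<open>Suc s\<close> and one entry \<open>z\<close>. If \<open>z < M\<close>, the tangent of \<open>e\<close> at \<open>Suc s\<close>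
  suffices; otherwise \<open>large\<close>, which is the eigenvalue equation at the root, bounds the cost of raising
  \<open>s\<close> to \<open>Suc s\<close>.
\<close>

lemma deficit_sum_less:
  assumes l: "l \<noteq> []" "\<And>x. x \<in> set l \<Longrightarrow> x \<le> M"
    and ys: "length ys = length l + 2" "\<And>y. y \<in> set ys \<Longrightarrow> Suc s \<le> y"
    and sum: "sum_list ys = s + sum_list l + M"
    and large: "real (length l + 1) - (\<Sum>y\<leftarrow>ys. e y) \<le> 1 / q"
  shows "(\<Sum>y\<leftarrow>ys. e y) < e s + (\<Sum>x\<leftarrow>l. e x) + e M"
proof -
  define d where "d = map (\<lambda>y. y - Suc s) ys"
  define r where "r = length l + 1"
  define z where "z = Suc s + sum_list d"
  have ysd: "ys = map (\<lambda>x. Suc s + x) d"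
    unfolding d_def map_map o_def
    by (rule sym, rule map_idI) (simp only: le_add_diff_inverse ys(2))
  have lend: "length d = r + 1" using ys(1) by (simp add: d_def r_def)
  have dne: "d \<noteq> []" using lend by (cases d) simp_all
  have up: "(\<Sum>y\<leftarrow>ys. e y) \<le> real r * e (Suc s) + e z"
    using deficit_merge[OF dne, of "Suc s"] lend by (simp add: arg_cong[OF ysd, of "\<lambda>ys. \<Sum>y\<leftarrow>ys. e y"] z_def o_def)
  have "sum_list ys = length d * Suc s + sum_list d"
    by (subst ysd) (induction d, auto)
  then have tot: "r * Suc s + z = s + sum_list l + M" using sum lend by (simp add: z_def)
  show ?thesis
  proof (cases "z < M")
    case True
    define \<delta> where "\<delta> = e s - e (Suc s)"
    obtain k where k: "M = z + k" "0 < k" using True less_imp_add_positive by blast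
    have rk: "real r * real (Suc s) = real s + real (sum_list l) + real k"
    proof -
      have "r * Suc s = s + sum_list l + k" using tot k by simp
      then have "real (r * Suc s) = real (s + sum_list l + k)" by (rule arg_cong)
      then show ?thesis by (simp only: of_nat_mult of_nat_add)
    qed
    have "real (length l) * e (Suc s) + \<delta> * (real (length l) * real (Suc s) - real (sum_list l)) \<le> (\<Sum>x\<leftarrow>l. e x)"
    proof (induction l)
      case (Cons x l)
      then show ?case using deficit_tangent[of s x] by (simp add: \<delta>_def algebra_simps)
    qed simp
    moreover have "real (length l) * real (Suc s) - real (sum_list l) = real k - 1"
      using rk by (simp add: r_def algebra_simps)
    ultimately have "real (length l) * e (Suc s) + \<delta> * (real k - 1) \<le> (\<Sum>x\<leftarrow>l. e x)" by simp
    then have low: "real r * e (Suc s) + \<delta> * real k \<le> e s + (\<Sum>x\<leftarrow>l. e x)"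
      by (simp add: \<delta>_def r_def algebra_simps)
    \<comment> \<open>From \<open>z\<close> on, which is at least \<open>Suc s\<close>, each drop is
      strictly smaller than \<delta>. This makes the result strict.\<close>
    have "e z - e (z + k) \<le> real k * (e (Suc s) - e (Suc (Suc s)))"
      by (rule deficit_drop_le) (simp add: z_def)
    also have "\<dots> < real k * \<delta>"
      unfolding \<delta>_def using k by (intro mult_strict_left_mono deficit_drop_Suc_less) simp
    finally show ?thesis using up low k by (simp add: mult.commute)
  next
    case False
    then have zM: "e z \<le> e M" by (intro deficit_antimono) simp
    show ?thesis
    proof (rule ccontr)
      assume "\<not> ?thesis"
      then have ge: "e s + (\<Sum>x\<leftarrow>l. e x) + e M \<le> real r * e (Suc s) + e z" using up by simp
      have es: "0 < e s" by (rule deficit_pos)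
      have ez: "0 < e z" by (rule deficit_pos)
      have X: "0 < 1 + q * e s" using q es by (simp add: add_pos_pos)
      have "q * e s \<le> c * q * e s" using c q es by simp
      then have e1: "e (Suc s) \<le> q * e s / (1 + q * e s)"
        unfolding eS using q es by (intro divide_left_mono mult_pos_pos) (auto simp: add_pos_pos)
      \<comment> \<open>The root condition becomes a bound on \<open>r\<close>. Multiplied by
        \<open>e s\<close>, it shows that \<open>r\<close> copies of \<open>e (Suc s)\<close> amount
        to at most \<open>e s * (1 + q * e z)\<close>, so that \<open>e s\<close> cancels against
        the left side of \<open>ge\<close>.\<close>
      have "real r * (1 / (1 + q * e s)) \<le> real r * (1 - e (Suc s))"
        using e1 X by (intro mult_left_mono) (auto simp: field_simps)
      also have "\<dots> \<le> 1 / q + e z" using large up by (simp add: r_def algebra_simps)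
      finally have rq: "real r * q / (1 + q * e s) \<le> 1 + q * e z"
        using q by (simp add: field_simps)
      have "real r * e (Suc s) \<le> real r * (q * e s / (1 + q * e s))"
        using e1 by (intro mult_left_mono) auto
      also have "\<dots> = e s * (real r * q / (1 + q * e s))" by simp
      also have "\<dots> \<le> e s * (1 + q * e z)" using rq es by (intro mult_left_mono) auto
      finally have le: "(\<Sum>x\<leftarrow>l. e x) + e M \<le> e z + q * e s * e z"
        using ge by (simp add: algebra_simps)
      have "q * e s < 1 * 1" using q es deficit_le_1[of s] by (intro mult_less_le_imp_less) auto
      then have "q * e s * e z < e z" using ez by simp
      with le have lt: "(\<Sum>x\<leftarrow>l. e x) + e M < 2 * e z" by simp
      \<comment> \<open>Here \<open>l\<close> must be nonempty: as \<open>x\<close> and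
        \<open>M\<close> are both at most \<open>z\<close>, two deficits of size at least
        \<open>e z\<close> face a bound strictly below \<open>2 * e z\<close>.\<close>
      obtain x l' where x: "l = x # l'" using l(1) by (cases l) auto
      have "0 \<le> (\<Sum>x\<leftarrow>l'. e x)" by (intro sum_list_nonneg) (auto simp: deficit_pos less_imp_le)
      moreover have "e M \<le> e x" using l(2) x by (intro deficit_antimono) simp
      ultimately show False using lt zM x by simp
    qed
  qed
qed

end

section \<open>Appended paths\<close>

lemma connected_closed_set:
  assumes G: "pair_graph G" "connected (with_proj G)" and v: "v \<in> S" "v \<in> pverts G" "z \<in> pverts G"
    and closed: "\<And>a b. a \<in> S \<Longrightarrow> (a, b) \<in> parcs G \<Longrightarrow> b \<in> S"
  shows "z \<in> S"
proof -
  interpret pair_graph G by (rule G)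
  have "v \<rightarrow>\<^sup>*\<^bsub>with_proj (mk_symmetric G)\<^esub> z"
    using G(2) v by (auto simp: connected_def strongly_connected_def)
  then have "v \<rightarrow>\<^sup>*\<^bsub>with_proj G\<^esub> z"
    using reachable_mk_symmetric_eq sym_arcs by blast
  then show ?thesis
    by (induction rule: reachable_induct) (use v closed in auto)
qed

text \<open>Every vertex is charged \<rho> except the first. That one is the root, which all paths
  share and which is charged once, in \<open>excess\<close>.\<close>

definition path_energy :: "real \<Rightarrow> real \<Rightarrow> nat \<Rightarrow> (nat \<Rightarrow> real) \<Rightarrow> real" where
  "path_energy \<alpha> \<rho> m y =
    (\<Sum>j<m. \<alpha> * ((y j)\<^sup>2 + (y (Suc j))\<^sup>2) + 2 * (1 - \<alpha>) * y j * y (Suc j) - \<rho> * (y (Suc j))\<^sup>2)"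

lemma path_energy_Suc:
  "path_energy \<alpha> \<rho> (Suc m) y =
    \<alpha> * ((y 0)\<^sup>2 + (y 1)\<^sup>2) + 2 * (1 - \<alpha>) * y 0 * y 1 - \<rho> * (y 1)\<^sup>2 + path_energy \<alpha> \<rho> m (\<lambda>j. y (Suc j))"
  unfolding path_energy_def sum.lessThan_Suc_shift by simp

lemma path_energy_le_branch:
  "admissible \<alpha> \<rho> m \<Longrightarrow> path_energy \<alpha> \<rho> m y \<le> branch \<alpha> \<rho> m * (y 0)\<^sup>2"
proof (induction m arbitrary: y)
  case (Suc m)
  let ?D = "\<rho> - \<alpha> - branch \<alpha> \<rho> m"
  have D: "0 < ?D" and adm: "admissible \<alpha> \<rho> m" using Suc.prems by (auto simp: admissible_Suc)
  have "path_energy \<alpha> \<rho> (Suc m) y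
      \<le> \<alpha> * ((y 0)\<^sup>2 + (y 1)\<^sup>2) + 2 * (1 - \<alpha>) * y 0 * y 1 - \<rho> * (y 1)\<^sup>2 + branch \<alpha> \<rho> m * (y 1)\<^sup>2"
    using Suc.IH[OF adm, of "\<lambda>j. y (Suc j)"] by (simp add: path_energy_Suc)
  also have "\<dots> = branch \<alpha> \<rho> (Suc m) * (y 0)\<^sup>2 - ((1 - \<alpha>) * y 0 - ?D * y 1)\<^sup>2 / ?D"
  proof -
    have "(a - d * b)\<^sup>2 / d = a\<^sup>2 / d - 2 * a * b + d * b\<^sup>2" if "0 < d" for a b d :: real
      using that by (simp add: power2_eq_square field_simps)
    from this[OF D, of "(1 - \<alpha>) * y 0" "y 1"] show ?thesis
      by (simp add: power_mult_distrib distrib_right) (simp add: algebra_simps)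
  qed
  also have "\<dots> \<le> branch \<alpha> \<rho> (Suc m) * (y 0)\<^sup>2" using D by simp
  finally show ?case .
qed (simp add: path_energy_def)

text \<open>The square lost in the upper bound vanishes when each value along the path is
  \<open>f\<close> times its predecessor.\<close>

lemma path_energy_attains_branch:
  "admissible \<alpha> \<rho> m \<Longrightarrow> \<exists>y. y 0 = s \<and> path_energy \<alpha> \<rho> m y = branch \<alpha> \<rho> m * s\<^sup>2"
proof (induction m arbitrary: s)
  case (Suc m)
  let ?D = "\<rho> - \<alpha> - branch \<alpha> \<rho> m"
  define f where "f = (1 - \<alpha>) / ?D"
  have D: "0 < ?D" and adm: "admissible \<alpha> \<rho> m" using Suc.prems by (auto simp: admissible_Suc)
  have Df: "?D * f = 1 - \<alpha>" using D by (simp add: f_def)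
  obtain y where y: "y 0 = f * s" "path_energy \<alpha> \<rho> m y = branch \<alpha> \<rho> m * (f * s)\<^sup>2"
    using Suc.IH[OF adm] by blast
  let ?y = "case_nat s y"
  have "path_energy \<alpha> \<rho> (Suc m) ?y
      = \<alpha> * s\<^sup>2 + 2 * (1 - \<alpha>) * s * (f * s) - (?D * f) * f * s\<^sup>2"
    unfolding path_energy_Suc using y by (simp add: power2_eq_square algebra_simps)
  also have "\<dots> = (\<alpha> + (1 - \<alpha>) * f) * s\<^sup>2"
    unfolding Df by (simp add: power2_eq_square algebra_simps)
  also have "\<alpha> + (1 - \<alpha>) * f = branch \<alpha> \<rho> (Suc m)"
    by (simp add: f_def power2_eq_square)
  finally show ?case by (intro exI[of _ ?y]) simp
qed (auto simp: path_energy_def)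

section \<open>Energy of a rooted graph with appended paths\<close>

locale rooted_graph =
  fixes G :: "'a pair_pre_digraph" and u :: 'a and \<alpha> :: real
  assumes G: "pair_graph G" and connected: "connected (with_proj G)" and u: "u \<in> pverts G"
    and \<alpha>: "0 \<le> \<alpha>" "\<alpha> < 1"
begin

sublocale pair_graph G by (rule G)

abbreviation H where "H xs \<equiv> append_paths G xs u"
abbreviation R where "R xs \<equiv> rho_alpha \<alpha> (H xs)"

definition \<Phi> :: "real \<Rightarrow> nat list \<Rightarrow> real" where
  "\<Phi> \<rho> xs = (\<Sum>x\<leftarrow>xs. branch \<alpha> \<rho> x)"

definition excess :: "real \<Rightarrow> ('a \<Rightarrow> real) \<Rightarrow> real" where
  "excess \<rho> w = alpha_form \<alpha> G w - \<rho> * (\<Sum>v\<in>pverts G. (w v)\<^sup>2)"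

lemma H: "pair_graph (H xs)"
  by (rule pair_graph_append_paths[OF G u])

lemma Inl_in_H: "v \<in> pverts G \<Longrightarrow> Inl v \<in> pverts (H xs)"
  by (simp add: append_paths_def)

lemma pverts_H_ne: "pverts (H xs) \<noteq> {}"
  using Inl_in_H[OF u] by blast

lemma path_vertex_in_H: "i < length xs \<Longrightarrow> j \<le> xs ! i \<Longrightarrow> path_vertex u i j \<in> pverts (H xs)"
  by (auto simp: append_paths_def)

lemma pverts_H:
  "pverts (H xs) = Inl ` pverts G \<union> (\<lambda>(i, j). Inr (i, Suc j)) ` (SIGMA i:{..<length xs}. {..<xs ! i})"
proof -
  have *: "path_vertex u i j \<in> Inl ` pverts G \<union> (\<lambda>(i, j). Inr (i, Suc j)) ` (SIGMA i:{..<length xs}. {..<xs ! i})"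
    if "i < length xs" "j \<le> xs ! i" for i j
    using that u by (cases j) (auto simp: path_vertex_def image_iff)
  have **: "Inr (i, Suc j) \<in> pverts (H xs)" if "i < length xs" "j < xs ! i" for i j
    using path_vertex_in_H[OF that(1), of "Suc j"] that(2) by (simp add: path_vertex_def)
  show ?thesis
  proof (intro equalityI subsetI)
    fix v assume "v \<in> pverts (H xs)"
    then show "v \<in> Inl ` pverts G \<union> (\<lambda>(i, j). Inr (i, Suc j)) ` (SIGMA i:{..<length xs}. {..<xs ! i})"
      using * by (auto simp: append_paths_def)
  qed (use ** Inl_in_H in auto)
qed

lemma sum_pverts_H:
  "(\<Sum>v\<in>pverts (H xs). f v) = (\<Sum>v\<in>pverts G. f (Inl v)) + (\<Sum>i<length xs. \<Sum>j<xs ! i. f (Inr (i, Suc j)))"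
proof -
  let ?I = "SIGMA i:{..<length xs}. {..<xs ! i}"
  have inj: "inj_on (\<lambda>(i, j). Inr (i, Suc j) :: 'a + nat \<times> nat) ?I"
    by (auto simp: inj_on_def)
  have "(\<Sum>v\<in>pverts (H xs). f v) = sum f (Inl ` pverts G) + sum f ((\<lambda>(i, j). Inr (i, Suc j)) ` ?I)"
    unfolding pverts_H by (rule sum.union_disjoint) auto
  also have "sum f (Inl ` pverts G) = (\<Sum>v\<in>pverts G. f (Inl v))"
    by (simp add: sum.reindex)
  also have "sum f ((\<lambda>(i, j). Inr (i, Suc j)) ` ?I) = (\<Sum>i<length xs. \<Sum>j<xs ! i. f (Inr (i, Suc j)))"
    by (subst sum.reindex[OF inj], subst sum.Sigma) (auto simp: case_prod_unfold)
  finally show ?thesis .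
qed

lemma alpha_form_H:
  "alpha_form \<alpha> (H xs) x = alpha_form \<alpha> G (\<lambda>v. x (Inl v)) +
    (\<Sum>i<length xs. \<Sum>j<xs ! i. \<alpha> * ((x (path_vertex u i j))\<^sup>2 + (x (path_vertex u i (Suc j)))\<^sup>2)
      + 2 * (1 - \<alpha>) * x (path_vertex u i j) * x (path_vertex u i (Suc j)))"
proof -
  let ?I = "SIGMA i:{..<length xs}. {..<xs ! i}"
  let ?f = "\<lambda>(v, z). \<alpha> * (x v)\<^sup>2 + (1 - \<alpha>) * x v * x z"
  define A B C :: "(('a + nat \<times> nat) \<times> ('a + nat \<times> nat)) set" where "A = map_prod Inl Inl ` parcs G"
    and "B = (\<lambda>(i, j). (path_vertex u i j, path_vertex u i (Suc j))) ` ?I"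
    and "C = (\<lambda>(i, j). (path_vertex u i (Suc j), path_vertex u i j)) ` ?I"
  have arcs: "parcs (H xs) = A \<union> (B \<union> C)"
    unfolding append_paths_def A_def B_def C_def by (auto simp: image_iff)
  have injB: "inj_on (\<lambda>(i, j). (path_vertex u i j, path_vertex u i (Suc j))) ?I"
    and injC: "inj_on (\<lambda>(i, j). (path_vertex u i (Suc j), path_vertex u i j)) ?I"
    by (auto simp: inj_on_def path_vertex_def)
  have fin: "finite A" "finite B" "finite C"
    unfolding A_def B_def C_def by auto
  have "A \<inter> (B \<union> C) = {}" "B \<inter> C = {}"
    unfolding A_def B_def C_def by (auto simp: path_vertex_def split: if_splits)
  then have "alpha_form \<alpha> (H xs) x = sum ?f A + (sum ?f B + sum ?f C)"
    unfolding alpha_form_def arcs using fin by (simp add: sum.union_disjoint)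
  also have "sum ?f A = alpha_form \<alpha> G (\<lambda>v. x (Inl v))"
    unfolding A_def alpha_form_def
    by (subst sum.reindex) (auto simp: inj_on_def case_prod_unfold)
  also have "sum ?f B = (\<Sum>i<length xs. \<Sum>j<xs ! i. ?f (path_vertex u i j, path_vertex u i (Suc j)))"
    unfolding B_def by (subst sum.reindex[OF injB], subst sum.Sigma) (auto simp: case_prod_unfold)
  also have "sum ?f C = (\<Sum>i<length xs. \<Sum>j<xs ! i. ?f (path_vertex u i (Suc j), path_vertex u i j))"
    unfolding C_def by (subst sum.reindex[OF injC], subst sum.Sigma) (auto simp: case_prod_unfold)
  finally show ?thesis
    by (simp add: sum.distrib[symmetric] algebra_simps)
qed

lemma energy_H:
  "alpha_form \<alpha> (H xs) x - \<rho> * (\<Sum>v\<in>pverts (H xs). (x v)\<^sup>2) =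
    excess \<rho> (\<lambda>v. x (Inl v)) + (\<Sum>i<length xs. path_energy \<alpha> \<rho> (xs ! i) (\<lambda>j. x (path_vertex u i j)))"
proof -
  have "Inr (i, Suc j) = path_vertex u i (Suc j)" for i j
    by (simp add: path_vertex_def)
  then show ?thesis
    unfolding alpha_form_H sum_pverts_H excess_def path_energy_def
    by (simp add: sum_subtractf sum_distrib_left algebra_simps)
qed

lemma \<Phi>_nth: "\<Phi> \<rho> xs = (\<Sum>i<length xs. branch \<alpha> \<rho> (xs ! i))"
  by (simp add: \<Phi>_def sum_list_sum_nth atLeast0LessThan)

text \<open>The function \<open>w\<close> on \<open>G\<close> is extended optimally along all paths
  and used as a test function. \<open>N\<close> is the squared norm of the extension; its lower
  bound lets the sign of the energy decide the sign of \<open>R xs - \<rho>\<close>.\<close>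

lemma excess_le_rho:
  assumes adm: "\<And>x. x \<in> set xs \<Longrightarrow> admissible \<alpha> \<rho> x"
  obtains N where "(w u)\<^sup>2 \<le> N" "excess \<rho> w + \<Phi> \<rho> xs * (w u)\<^sup>2 \<le> (R xs - \<rho>) * N"
proof -
  have "\<exists>y. y 0 = w u \<and> path_energy \<alpha> \<rho> (xs ! i) y = branch \<alpha> \<rho> (xs ! i) * (w u)\<^sup>2"
    if "i < length xs" for i
    using path_energy_attains_branch[OF adm[OF nth_mem[OF that]]] .
  then obtain y where y: "\<And>i. i < length xs \<Longrightarrow> y i 0 = w u"
    "\<And>i. i < length xs \<Longrightarrow> path_energy \<alpha> \<rho> (xs ! i) (y i) = branch \<alpha> \<rho> (xs ! i) * (w u)\<^sup>2"
    by metis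
  define x where "x = case_sum w (\<lambda>(i, j). y i j)"
  define N where "N = (\<Sum>v\<in>pverts (H xs). (x v)\<^sup>2)"
  have wl: "(\<lambda>v. x (Inl v)) = w" by (simp add: x_def)
  have px: "(\<lambda>j. x (path_vertex u i j)) = y i" if "i < length xs" for i
    using y(1)[OF that] by (auto simp: x_def path_vertex_def)
  have "alpha_form \<alpha> (H xs) x - \<rho> * N = excess \<rho> w + \<Phi> \<rho> xs * (w u)\<^sup>2"
    unfolding N_def energy_H wl by (simp add: px y(2) \<Phi>_nth sum_distrib_right)
  moreover have "alpha_form \<alpha> (H xs) x \<le> R xs * N"
    unfolding N_def using rho_alpha_rayleigh[OF H pverts_H_ne, of \<alpha>] \<alpha> by (meson less_imp_le)
  ultimately have "excess \<rho> w + \<Phi> \<rho> xs * (w u)\<^sup>2 \<le> (R xs - \<rho>) * N" by (simp add: algebra_simps)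
  moreover have "(x (Inl u))\<^sup>2 \<le> N"
    unfolding N_def by (rule member_le_sum[OF Inl_in_H[OF u]]) (simp_all add: pverts_H)
  ultimately show ?thesis using that[of N] by (simp add: x_def)
qed

lemma less_rho:
  assumes "\<And>x. x \<in> set xs \<Longrightarrow> admissible \<alpha> \<rho> x" and pos: "0 < excess \<rho> w + \<Phi> \<rho> xs * (w u)\<^sup>2"
  shows "\<rho> < R xs"
proof -
  obtain N where N: "(w u)\<^sup>2 \<le> N" "excess \<rho> w + \<Phi> \<rho> xs * (w u)\<^sup>2 \<le> (R xs - \<rho>) * N"
    using excess_le_rho[OF assms(1)] .
  have "0 \<le> N" using N(1) by (meson order_trans zero_le_power2)
  moreover have "0 < (R xs - \<rho>) * N" using N(2) pos by simp
  ultimately show ?thesis by (simp add: zero_less_mult_iff)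
qed

lemma le_rho:
  assumes "\<And>x. x \<in> set xs \<Longrightarrow> admissible \<alpha> \<rho> x" and pos: "0 \<le> excess \<rho> w + \<Phi> \<rho> xs * (w u)\<^sup>2"
    and wu: "w u \<noteq> 0"
  shows "\<rho> \<le> R xs"
proof -
  obtain N where N: "(w u)\<^sup>2 \<le> N" "excess \<rho> w + \<Phi> \<rho> xs * (w u)\<^sup>2 \<le> (R xs - \<rho>) * N"
    using excess_le_rho[OF assms(1)] .
  have "0 < N" using N(1) wu by (meson less_le_trans zero_less_power2)
  moreover have "0 \<le> (R xs - \<rho>) * N" using N(2) pos by simp
  ultimately show ?thesis by (simp add: zero_le_mult_iff)
qed

lemma path_arcs_H:
  assumes "i < length xs" "j < xs ! i"
  shows "(path_vertex u i j, path_vertex u i (Suc j)) \<in> parcs (H xs)"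
    and "(path_vertex u i (Suc j), path_vertex u i j) \<in> parcs (H xs)"
  using assms by (auto simp: append_paths_def)

lemma nbrs_path_vertex:
  assumes "i < length xs" "j < xs ! i"
  shows "nbrs (H xs) (path_vertex u i (Suc j)) =
    insert (path_vertex u i j) (if Suc j < xs ! i then {path_vertex u i (Suc (Suc j))} else {})"
  using assms by (auto simp: append_paths_def path_vertex_def split: if_splits)

lemma eigenfunction_zero_nbr:
  assumes w: "\<And>v. 0 \<le> w v" and ev: "(\<Sum>z\<in>nbrs (H xs) v. \<alpha> * w v + (1 - \<alpha>) * w z) = \<rho> * w v"
    and z: "w v = 0" "(v, z) \<in> parcs (H xs)"
  shows "w z = 0"
proof -
  have "(\<Sum>z\<in>nbrs (H xs) v. (1 - \<alpha>) * w z) = 0" using ev z(1) by simp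
  then have "\<forall>z\<in>nbrs (H xs) v. (1 - \<alpha>) * w z = 0"
    by (subst (asm) sum_nonneg_eq_0_iff) (use finite_nbrs[OF H] w \<alpha> in auto)
  then show ?thesis using z(2) \<alpha> by auto
qed

text \<open>Where a nonnegative eigenfunction vanishes, all neighbours vanish as well, since
  \<alpha> < 1. Zeros thus spread through \<open>G\<close> by connectedness and along the paths in
  both directions.\<close>

lemma perron:
  obtains w where "\<And>v. v \<in> pverts (H xs) \<Longrightarrow> 0 < w v"
    and "\<And>v. v \<in> pverts (H xs) \<Longrightarrow> (\<Sum>z\<in>nbrs (H xs) v. \<alpha> * w v + (1 - \<alpha>) * w z) = R xs * w v"
proof -
  obtain w where w0: "\<And>v. 0 \<le> w v" and w1: "\<exists>v\<in>pverts (H xs). 0 < w v"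
    and ev: "\<And>v. v \<in> pverts (H xs) \<Longrightarrow> (\<Sum>z\<in>nbrs (H xs) v. \<alpha> * w v + (1 - \<alpha>) * w z) = R xs * w v"
    using rho_alpha_rayleigh[OF H pverts_H_ne, of \<alpha>] \<alpha> by (metis less_imp_le)
  have step: "w z = 0" if "v \<in> pverts (H xs)" "w v = 0" "(v, z) \<in> parcs (H xs)" for v z
    using eigenfunction_zero_nbr[OF w0 ev] that by blast
  have Inl_step: "w (Inl b) = 0" if "w (Inl a) = 0" "(a, b) \<in> parcs G" for a b
  proof (rule step[OF _ that(1)])
    show "Inl a \<in> pverts (H xs)" using in_arcsD1[OF that(2)] by (rule Inl_in_H)
    show "(Inl a, Inl b) \<in> parcs (H xs)"
      using map_prod_imageI[OF that(2), of "Inl :: 'a \<Rightarrow> 'a + nat \<times> nat" "Inl :: 'a \<Rightarrow> 'a + nat \<times> nat"] by (simp add: append_paths_def)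
  qed
  have G_zero: "w (Inl b) = 0" if "w (Inl a) = 0" "a \<in> pverts G" "b \<in> pverts G" for a b
    using connected_closed_set[OF G connected, of a "{a. w (Inl a) = 0}" b] that Inl_step by blast
  have nz: "w (Inl u) \<noteq> 0"
  proof
    assume u0: "w (Inl u) = 0"
    have path: "w (path_vertex u i j) = 0" if "i < length xs" "j \<le> xs ! i" for i j
      using that(2)
    proof (induction j)
      case (Suc j)
      then show ?case using path_arcs_H(1)[OF that(1), of j] step path_vertex_in_H[OF that(1), of j] by auto
    qed (simp add: path_vertex_def u0)
    have "w v = 0" if "v \<in> pverts (H xs)" for v
      using that path G_zero[OF u0 u] by (auto simp: append_paths_def)
    then show False using w1 by auto
  qed
  have "w v \<noteq> 0" if v: "v \<in> pverts (H xs)" for v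
  proof
    assume v0: "w v = 0"
    have down: "w (path_vertex u i 0) = 0" if "i < length xs" "j \<le> xs ! i" "w (path_vertex u i j) = 0" for i j
      using that(2,3)
    proof (induction j)
      case (Suc j)
      then show ?case using path_arcs_H(2)[OF that(1), of j] step path_vertex_in_H[OF that(1), of "Suc j"] by auto
    qed
    have "w (Inl u) = 0"
      using v v0 down G_zero[OF _ _ u] unfolding append_paths_def by (auto simp: path_vertex_def[of u _ 0])
    then show False using nz by simp
  qed
  then show ?thesis using that[of w] w0 ev by (simp add: less_le)
qed

text \<open>The positive eigenfunction gives both claims. Quotients of its consecutive values along
  a path are, up to the factor 1 - \<alpha>, the gaps in the definition of \<open>branch\<close>, so
  these are positive. Its total energy is 0, and the branch values bound the energies of the paths
  from above.\<close>

lemma rho_admissible_excess: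
  obtains w where "0 < w u" "0 \<le> excess (R xs) w + \<Phi> (R xs) xs * (w u)\<^sup>2"
    "\<And>x. x \<in> set xs \<Longrightarrow> admissible \<alpha> (R xs) x"
proof -
  obtain x where pos: "\<And>v. v \<in> pverts (H xs) \<Longrightarrow> 0 < x v"
    and ev: "\<And>v. v \<in> pverts (H xs) \<Longrightarrow> (\<Sum>z\<in>nbrs (H xs) v. \<alpha> * x v + (1 - \<alpha>) * x z) = R xs * x v"
    by (rule perron[of xs]) blast
  have adm: "admissible \<alpha> (R xs) (xs ! i)" if i: "i < length xs" for i
  proof -
    define m where "m = xs ! i"
    define y where "y j = x (path_vertex u i j)" for j
    define F where "F = branch \<alpha> (R xs)"
    have ypos: "0 < y j" if "j \<le> m" for j
      unfolding y_def using i that by (intro pos path_vertex_in_H) (simp_all add: m_def)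
    have distinct: "path_vertex u i j \<noteq> path_vertex u i (Suc (Suc j))" for j
      by (simp add: path_vertex_def)
    have eq: "R xs * y (Suc j) = \<alpha> * y (Suc j) + (1 - \<alpha>) * y j
        + (if Suc j < m then \<alpha> * y (Suc j) + (1 - \<alpha>) * y (Suc (Suc j)) else 0)" if "j < m" for j
      using ev[OF path_vertex_in_H[OF i, of "Suc j"]] nbrs_path_vertex[OF i, of j] that distinct[of j]
      by (auto simp: y_def m_def)
    \<comment> \<open>\<open>k\<close> counts from the free end: beyond the vertex
      \<open>m - k\<close> hangs a branch of length \<open>k\<close>, and the identity is the
      eigenvalue equation at that vertex with this branch eliminated.\<close>
    have "F k < R xs - \<alpha> \<and> (R xs - \<alpha> - F k) * y (m - k) = (1 - \<alpha>) * y (m - Suc k)" if "k < m" for k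
      using that
    proof (induction k)
      case 0
      then have e: "(R xs - \<alpha>) * y m = (1 - \<alpha>) * y (m - 1)"
        using eq[of "m - 1"] by (simp add: algebra_simps)
      then have "0 < (R xs - \<alpha>) * y m" using \<alpha> ypos[of "m - 1"] by (simp only: mult_pos_pos diff_gt_0_iff_gt)
      then have "0 < R xs - \<alpha>" by (rule zero_less_mult_pos2) (simp add: ypos)
      with e show ?case by (simp add: F_def)
    next
      case (Suc k)
      let ?D = "R xs - \<alpha> - F k"
      have D: "0 < ?D" and IH: "?D * y (m - k) = (1 - \<alpha>) * y (m - Suc k)" using Suc by auto
      then have yk: "y (m - k) = (1 - \<alpha>) / ?D * y (m - Suc k)" by (simp add: field_simps)
      have idx: "Suc (m - Suc (Suc k)) = m - Suc k" "Suc (m - Suc k) = m - k"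
        using Suc.prems by auto
      have "R xs * y (m - Suc k) = \<alpha> * y (m - Suc k) + (1 - \<alpha>) * y (m - Suc (Suc k))
          + (\<alpha> * y (m - Suc k) + (1 - \<alpha>) * y (m - k))"
        using eq[of "m - Suc (Suc k)"] Suc.prems unfolding idx by simp
      then have e: "(R xs - \<alpha> - F (Suc k)) * y (m - Suc k) = (1 - \<alpha>) * y (m - Suc (Suc k))"
        unfolding yk F_def by (simp add: algebra_simps power2_eq_square)
      then have "0 < (R xs - \<alpha> - F (Suc k)) * y (m - Suc k)"
        using \<alpha> ypos[of "m - Suc (Suc k)"] by simp
      then have "0 < R xs - \<alpha> - F (Suc k)" by (rule zero_less_mult_pos2) (simp add: ypos)
      with e show ?case by simp
    qed
    then show ?thesis by (simp add: admissible_def F_def m_def)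
  qed
  let ?w = "\<lambda>v. x (Inl v)"
  have "0 = alpha_form \<alpha> (H xs) x - R xs * (\<Sum>v\<in>pverts (H xs). (x v)\<^sup>2)"
    using alpha_form_eigenfunction[OF H ev] by simp
  also have "\<dots> \<le> excess (R xs) ?w + \<Phi> (R xs) xs * (?w u)\<^sup>2"
    unfolding energy_H \<Phi>_nth sum_distrib_right
  proof (intro add_left_mono sum_mono)
    fix i assume "i \<in> {..<length xs}"
    then show "path_energy \<alpha> (R xs) (xs ! i) (\<lambda>j. x (path_vertex u i j)) \<le> branch \<alpha> (R xs) (xs ! i) * (?w u)\<^sup>2"
      using path_energy_le_branch[OF adm, of i "\<lambda>j. x (path_vertex u i j)"] by (simp add: path_vertex_def)
  qed
  finally show ?thesis
    using that[of ?w] pos[OF Inl_in_H[OF u]] adm by (metis in_set_conv_nth)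
qed

lemma rho_admissible: "x \<in> set xs \<Longrightarrow> admissible \<alpha> (R xs) x"
  using rho_admissible_excess by metis

text \<open>The eigenfunction for \<open>xs\<close>, restricted to \<open>G\<close>, is the test
  function for \<open>ys\<close>; the energy on \<open>G\<close> is the same for both.\<close>

lemma rho_less_if_\<Phi>_less:
  assumes "\<And>y. y \<in> set ys \<Longrightarrow> admissible \<alpha> (R xs) y" and "\<Phi> (R xs) xs < \<Phi> (R xs) ys"
  shows "R xs < R ys"
proof -
  obtain w where w: "0 < w u" "0 \<le> excess (R xs) w + \<Phi> (R xs) xs * (w u)\<^sup>2"
    by (rule rho_admissible_excess)
  have "\<Phi> (R xs) xs * (w u)\<^sup>2 < \<Phi> (R xs) ys * (w u)\<^sup>2" using w(1) assms(2) by simp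
  then show ?thesis using w(2) by (intro less_rho[where w = w] assms(1)) auto
qed

lemma rho_le_if_\<Phi>_le:
  assumes "\<And>y. y \<in> set ys \<Longrightarrow> admissible \<alpha> (R xs) y" and "\<Phi> (R xs) xs \<le> \<Phi> (R xs) ys"
  shows "R xs \<le> R ys"
proof -
  obtain w where w: "0 < w u" "0 \<le> excess (R xs) w + \<Phi> (R xs) xs * (w u)\<^sup>2"
    by (rule rho_admissible_excess)
  have "\<Phi> (R xs) xs * (w u)\<^sup>2 \<le> \<Phi> (R xs) ys * (w u)\<^sup>2" by (intro mult_right_mono assms(2)) simp
  then have "0 \<le> excess (R xs) w + \<Phi> (R xs) ys * (w u)\<^sup>2" using w(2) by linarith
  from le_rho[OF assms(1) this] w(1) show ?thesis by simp
qed

lemma alpha_form_nonneg: "(\<And>v. 0 \<le> w v) \<Longrightarrow> 0 \<le> alpha_form \<alpha> G w"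
  unfolding alpha_form_def using \<alpha> by (intro sum_nonneg) (auto intro!: add_nonneg_nonneg mult_nonneg_nonneg)

text \<open>The indicator of the root, extended optimally along the paths, has energy at least
  \<open>\<Phi> \<rho> xs - \<rho>\<close>.\<close>

lemma \<Phi>_le_rho: "\<Phi> (R xs) xs \<le> R xs"
proof (rule ccontr)
  assume *: "\<not> ?thesis"
  let ?w = "\<lambda>v. if v = u then 1 else 0 :: real"
  have "0 \<le> alpha_form \<alpha> G ?w" by (rule alpha_form_nonneg) simp
  moreover have "(\<Sum>v\<in>pverts G. (?w v)\<^sup>2) = 1"
    using u by (simp add: if_distrib[of "\<lambda>x. x\<^sup>2"] cong: if_cong)
  ultimately have "R xs < R xs"
    using * by (intro less_rho[where w = ?w] rho_admissible) (auto simp: excess_def)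
  then show False by simp
qed

lemma \<Phi>_gt_imp_rho_gt:
  assumes "\<And>x. x \<in> set xs \<Longrightarrow> admissible \<alpha> \<rho> x" and "\<rho> < \<Phi> \<rho> xs"
  shows "\<rho> < R xs"
proof -
  let ?w = "\<lambda>v. if v = u then 1 else 0 :: real"
  have "0 \<le> alpha_form \<alpha> G ?w" by (rule alpha_form_nonneg) simp
  moreover have "(\<Sum>v\<in>pverts G. (?w v)\<^sup>2) = 1"
    using u by (simp add: if_distrib[of "\<lambda>x. x\<^sup>2"] cong: if_cong)
  ultimately show ?thesis
    using assms by (intro less_rho[where w = ?w]) (auto simp: excess_def)
qed

text \<open>The test function is 1 at the root and \<open>c\<close> at one neighbour. Only the two
  arcs of this edge are kept; the other arcs contribute nonnegative terms.\<close>

lemma edge_\<Phi>_gt_imp_rho_gt: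
  assumes uv: "(u, v) \<in> parcs G" and "\<And>x. x \<in> set xs \<Longrightarrow> admissible \<alpha> \<rho> x" and "0 \<le> c"
    and "\<rho> * (1 + c\<^sup>2) < \<alpha> * (1 + c\<^sup>2) + 2 * (1 - \<alpha>) * c + \<Phi> \<rho> xs"
  shows "\<rho> < R xs"
proof -
  define w where "w z = (if z = u then 1 else if z = v then c else 0)" for z
  have w0: "0 \<le> w z" for z using assms(3) by (simp add: w_def)
  have ne: "u \<noteq> v" using uv no_loops' by blast
  have v: "v \<in> pverts G" using uv in_arcsD2 by blast
  have vu: "(v, u) \<in> parcs G" using uv pair_sym_arcs by (auto simp: symmetric_def sym_def)
  have "(\<Sum>(a, b)\<in>{(u, v), (v, u)}. \<alpha> * (w a)\<^sup>2 + (1 - \<alpha>) * w a * w b) \<le> alpha_form \<alpha> G w"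
    unfolding alpha_form_def
    by (rule sum_mono2) (use uv vu \<alpha> w0 in \<open>auto intro!: add_nonneg_nonneg mult_nonneg_nonneg\<close>)
  then have "\<alpha> * (1 + c\<^sup>2) + 2 * (1 - \<alpha>) * c \<le> alpha_form \<alpha> G w"
    using ne by (simp add: w_def algebra_simps)
  moreover have "(\<Sum>z\<in>pverts G. (w z)\<^sup>2) = 1 + c\<^sup>2"
  proof -
    have "(\<Sum>z\<in>pverts G. (w z)\<^sup>2) = (\<Sum>z\<in>{u, v}. (w z)\<^sup>2)"
      by (rule sum.mono_neutral_right) (use u v in \<open>auto simp: w_def\<close>)
    then show ?thesis using ne by (simp add: w_def)
  qed
  ultimately show ?thesis
    using assms(4) by (intro less_rho[where w = w] assms(2)) (auto simp: excess_def w_def)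
qed

lemma edge_\<Phi>_less_rho:
  assumes uv: "(u, v) \<in> parcs G"
  shows "\<Phi> (R xs) xs < R xs"
proof (rule ccontr)
  assume *: "\<not> ?thesis"
  then have eq: "\<Phi> (R xs) xs = R xs" using \<Phi>_le_rho[of xs] by simp
  \<comment> \<open>So small that the gain of the edge, linear in \<open>c\<close>, exceeds the loss
    \<open>R xs * c\<^sup>2\<close>.\<close>
  define c where "c = (1 - \<alpha>) / (1 + \<bar>R xs\<bar>)"
  have c: "0 < c" using \<alpha> by (simp add: c_def add_pos_nonneg)
  have "R xs * c < 2 * (1 - \<alpha>)"
  proof -
    have "R xs * c \<le> (1 + \<bar>R xs\<bar>) * c" using c by (intro mult_right_mono) auto
    also have "\<dots> = 1 - \<alpha>" by (simp add: c_def)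
    finally show ?thesis using \<alpha> by simp
  qed
  then have "R xs * c\<^sup>2 < 2 * (1 - \<alpha>) * c" using c by (simp add: power2_eq_square)
  moreover have "0 \<le> \<alpha> * (1 + c\<^sup>2)" using \<alpha> by simp
  ultimately have "R xs < R xs"
    using eq c by (intro edge_\<Phi>_gt_imp_rho_gt[OF uv rho_admissible, where c = c]) (auto simp: algebra_simps)
  then show False by simp
qed

end

section \<open>Comparing lists of path lengths\<close>

context rooted_graph
begin

text \<open>\<open>\<Phi>\<close> ignores order and zero entries, so comparing branch sums both ways
  proves the invariance without an isomorphism.\<close>

lemma R_cong:
  assumes "mset (filter ((<) 0) xs) = mset (filter ((<) 0) ys)"
  shows "R xs = R ys"
proof -
  have *: "\<Phi> \<rho> zs = sum_mset (image_mset (branch \<alpha> \<rho>) (mset (filter ((<) 0) zs)))" for \<rho> zs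
    unfolding \<Phi>_def
    by (subst sum_list_map_filter[of zs "(<) 0" "branch \<alpha> \<rho>", symmetric])
      (auto simp flip: sum_mset_sum_list)
  have le: "R xs \<le> R ys" if "mset (filter ((<) 0) xs) = mset (filter ((<) 0) ys)" for xs ys
  proof (rule rho_le_if_\<Phi>_le)
    show "\<Phi> (R xs) xs \<le> \<Phi> (R xs) ys" by (simp only: * that order.refl)
    fix y assume y: "y \<in> set ys"
    show "admissible \<alpha> (R xs) y"
    proof (cases "y = 0")
      case False
      then have "y \<in> set (filter ((<) 0) xs)" using y mset_eq_setD[OF that] by auto
      then show ?thesis by (auto intro: rho_admissible)
    qed simp
  qed
  show ?thesis using le[OF assms] le[OF assms[symmetric]] by simp
qed

text \<open>Something hangs at the root besides the two paths to be balanced. Otherwise the whole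
  graph is a path, whose spectral radius does not depend on the position of the root.\<close>

definition nontrivial :: "nat list \<Rightarrow> bool" where
  "nontrivial l \<longleftrightarrow> (\<exists>v. (u, v) \<in> parcs G) \<or> (\<exists>z\<in>set l. 0 < z)"

text \<open>Nontriviality provides the strict bound on two branch values that
  \<open>branch_smoothing\<close> requires: an edge of \<open>G\<close> at the root makes
  \<open>\<Phi>\<close> strictly less than \<rho>, and another path takes a positive share of
  \<open>\<Phi>\<close>.\<close>

lemma rho_smoothing:
  assumes nt: "nontrivial l" and xy: "x + 2 \<le> y"
  shows "R (x # y # l) < R ((x + 1) # (y - 1) # l)"
proof (rule rho_less_if_\<Phi>_less)
  let ?a = "x # y # l"
  let ?F = "branch \<alpha> (R ?a)"
  have adm: "admissible \<alpha> (R ?a) z" if "z \<in> set ?a" for z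
    using rho_admissible that .
  have nn: "0 \<le> \<Phi> (R ?a) l"
    unfolding \<Phi>_def using branch_nonneg[OF \<alpha>] adm by (intro sum_list_nonneg) auto
  have "?F x + ?F y < R ?a"
  proof (cases "\<exists>v. (u, v) \<in> parcs G")
    case True
    then obtain v where "(u, v) \<in> parcs G" by blast
    from edge_\<Phi>_less_rho[OF this, of ?a] nn show ?thesis by (simp add: \<Phi>_def)
  next
    case False
    then obtain z where z: "z \<in> set l" "0 < z" using nt by (auto simp: nontrivial_def)
    have "0 < ?F z" using branch_pos[OF \<alpha> adm] z by simp
    also have "?F z \<le> \<Phi> (R ?a) l"
      unfolding \<Phi>_def by (rule member_le_sum_list) (use z branch_nonneg[OF \<alpha>] adm in auto)
    finally show ?thesis using \<Phi>_le_rho[of ?a] by (simp add: \<Phi>_def)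
  qed
  then show "\<Phi> (R ?a) ?a < \<Phi> (R ?a) ((x + 1) # (y - 1) # l)"
    using branch_smoothing[OF \<alpha> adm, of y x] xy by (simp add: \<Phi>_def)
  fix z assume "z \<in> set ((x + 1) # (y - 1) # l)"
  then show "admissible \<alpha> (R ?a) z"
    using adm admissible_mono[OF adm, of y z] xy by auto
qed

lemma rho_balance:
  assumes "nontrivial l" and "x < x'" and "x' \<le> y'" and "x + y = x' + y'"
  shows "R (x # y # l) < R (x' # y' # l)"
  using assms(2-)
proof (induction x' arbitrary: y')
  case (Suc k)
  show ?case
  proof (cases "x = k")
    case True
    then have "x + 2 \<le> y" "y - 1 = y'" using Suc.prems by auto
    then show ?thesis using rho_smoothing[OF assms(1), of x y] True by simp
  next
    case False
    then have "R (x # y # l) < R (k # Suc y' # l)" using Suc by simp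
    also have "\<dots> < R (Suc k # y' # l)"
      using rho_smoothing[OF assms(1), of k "Suc y'"] Suc.prems by simp
    finally show ?thesis .
  qed
qed simp

lemma rho_split:
  assumes "nontrivial l" and "x < x'" and "x < y'" and "x + y = x' + y'"
  shows "R (x # y # l) < R (x' # y' # l)"
proof (cases "x' \<le> y'")
  case True
  then show ?thesis using assms by (intro rho_balance)
next
  case False
  then have "R (x # y # l) < R (y' # x' # l)" using assms by (intro rho_balance) auto
  also have "\<dots> = R (x' # y' # l)" by (rule R_cong) auto
  finally show ?thesis .
qed

text \<open>Pieces are split off the merged path one at a time; equality is left only for a single
  piece.\<close>

lemma rho_merge_le:
  assumes "nontrivial l" and "xs \<noteq> []" and "\<forall>x\<in>set xs. 0 < x"
  shows "R (l @ [sum_list xs]) \<le> R (l @ xs)"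
  using assms
proof (induction xs arbitrary: l)
  case (Cons x xs)
  show ?case
  proof (cases "xs = []")
    case False
    then have S: "0 < sum_list xs" using Cons.prems by (cases xs) auto
    have "R (l @ [sum_list (x # xs)]) = R (0 # (x + sum_list xs) # l)"
      by (rule R_cong) (use S in \<open>simp add: union_commute\<close>)
    also have "\<dots> < R (x # sum_list xs # l)"
      using Cons.prems S by (intro rho_split) auto
    also have "\<dots> = R ((l @ [x]) @ [sum_list xs])"
      by (rule R_cong) (use S Cons.prems in \<open>simp add: union_commute\<close>)
    also have "\<dots> \<le> R ((l @ [x]) @ xs)"
      using Cons.prems False by (intro Cons.IH) (auto simp: nontrivial_def)
    finally show ?thesis by simp
  qed simp
qed simp

text \<open>The root bound is known for \<open>a\<close>, not for \<open>b\<close>. Arguing by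
  contradiction transfers it, since failure of the claim gives
  \<open>\<Phi> (R a) b \<le> \<Phi> (R a) a\<close>. Deficits are at most 1, so the common prefix
  then drops out of the bound.\<close>

lemma rho_less_of_rho_gt_2:
  assumes a: "a = pre @ s # l @ [M]" and b: "b = pre @ ys" and R2: "2 < R a"
    and l: "l \<noteq> []" "\<And>x. x \<in> set l \<Longrightarrow> x \<le> M"
    and ys: "length ys = length l + 2" "\<And>y. y \<in> set ys \<Longrightarrow> Suc s \<le> y"
    and sum: "sum_list ys = s + sum_list l + M"
  shows "R a < R b"
proof (rule ccontr)
  assume not_less: "\<not> R a < R b"
  obtain L q c :: real and e :: "nat \<Rightarrow> real" where
    L: "0 < L" and q: "0 < q" "q < 1" and c: "1 \<le> c" and e0: "e 0 = 1"
    and eS: "\<And>m. e (Suc m) = q * e m / (1 + c * q * e m)"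
    and F: "\<And>m. branch \<alpha> (R a) m = L * (1 - e m)"
    and adm: "\<And>m. admissible \<alpha> (R a) m" and le: "R a \<le> L * (1 + 1 / q)"
    using branch_deficit[OF \<alpha> R2] by blast
  have \<Phi>: "\<Phi> (R a) xs = L * (real (length xs) - (\<Sum>x\<leftarrow>xs. e x))" for xs
    unfolding \<Phi>_def F by (induction xs) (auto simp: algebra_simps)
  have ba: "\<Phi> (R a) b \<le> \<Phi> (R a) a"
    using not_less rho_less_if_\<Phi>_less[of b a] adm by force
  also have "\<dots> \<le> L * (1 + 1 / q)" using \<Phi>_le_rho[of a] le by simp
  finally have "real (length b) - (\<Sum>x\<leftarrow>b. e x) \<le> 1 + 1 / q"
    unfolding \<Phi> using L by simp
  moreover have "(\<Sum>x\<leftarrow>pre. e x) \<le> real (length pre)"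
    using deficit_le_1[OF q c e0 eS] by (induction pre) (auto intro: add_mono)
  ultimately have "real (length l + 1) - (\<Sum>y\<leftarrow>ys. e y) \<le> 1 / q"
    using ys(1) by (simp add: b)
  from deficit_sum_less[OF q c e0 eS l ys sum this]
  have "\<Phi> (R a) a < \<Phi> (R a) b"
    unfolding \<Phi> using L ys(1) by (simp add: a b)
  with ba show False by simp
qed

section \<open>The borderline value \<rho> = 2\<close>

lemma branch_2: "branch \<alpha> 2 m = real m / (real m + (1 - \<alpha>))"
proof (induction m)
  case (Suc m)
  define b where "b = 1 - \<alpha>"
  have b: "0 < b" "\<alpha> = 1 - b" using \<alpha> by (auto simp: b_def)
  have mb: "0 < real m + b" "0 < real m + b + 1" using b by auto
  have "2 - \<alpha> - real m / (real m + b) = b * (real m + b + 1) / (real m + b)"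
  proof -
    have eq: "2 - \<alpha> = 1 + b" by (simp add: b_def)
    show ?thesis unfolding eq using mb by (simp add: field_simps)
  qed
  then have "branch \<alpha> 2 (Suc m) = \<alpha> + b * (real m + b) / (real m + b + 1)"
    using Suc b mb by (simp add: b_def[symmetric] power2_eq_square)
  also have "\<dots> = (real m + 1) / (real m + b + 1)"
  proof -
    have "\<alpha> * (real m + b + 1) + b * (real m + b) = real m + 1"
      unfolding b(2) by (simp add: algebra_simps)
    then show ?thesis using mb by (simp add: add_divide_eq_iff)
  qed
  finally show ?case by (simp add: b_def algebra_simps)
qed simp

lemma admissible_2: "admissible \<alpha> 2 m"
proof -
  have "branch \<alpha> 2 k < 2 - \<alpha>" for k
  proof -
    have "branch \<alpha> 2 k \<le> 1" unfolding branch_2 using \<alpha> by (simp add: divide_le_eq)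
    then show ?thesis using \<alpha> by simp
  qed
  then show ?thesis by (simp add: admissible_def)
qed

text \<open>The lower bound is the value for \<alpha> = 0, which makes the later case analysis
  uniform in \<alpha>.\<close>

lemma branch_2_ge: "k \<le> m \<Longrightarrow> real k / (real k + 1) \<le> branch \<alpha> 2 m"
proof -
  assume "k \<le> m"
  then have "real k / (real k + 1) \<le> real m / (real m + 1)" by (simp add: field_simps)
  also have "\<dots> \<le> branch \<alpha> 2 m"
    unfolding branch_2 using \<alpha> by (cases "m = 0") (auto intro!: divide_left_mono mult_pos_pos add_pos_pos)
  finally show ?thesis .
qed

text \<open>An edge of \<open>G\<close> at the root counts for at least 1 / 2, like a path of length
  1. The value 1 / 2 at the neighbour maximises 2 * c - 2 * c^2, the contribution of the edge for
  \<alpha> = 0.\<close>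

lemma rho_gt_2:
  assumes "2 < \<Phi> 2 xs \<or> (\<exists>v. (u, v) \<in> parcs G) \<and> 3 / 2 < \<Phi> 2 xs"
  shows "2 < R xs"
proof (cases "2 < \<Phi> 2 xs")
  case True
  then show ?thesis using \<Phi>_gt_imp_rho_gt admissible_2 by blast
next
  case False
  then obtain v where "(u, v) \<in> parcs G" "3 / 2 < \<Phi> 2 xs" using assms by blast
  then show ?thesis
    using \<alpha> by (intro edge_\<Phi>_gt_imp_rho_gt[where c = "1 / 2"] admissible_2) (auto simp: power2_eq_square field_simps)
qed

lemma \<Phi>_2_ge: "\<forall>x\<in>set xs. 0 < x \<Longrightarrow> real (length xs) / 2 \<le> \<Phi> 2 xs"
proof (induction xs)
  case (Cons x xs)
  then show ?case using branch_2_ge[of 1 x] by (simp add: \<Phi>_def field_simps)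
qed (simp add: \<Phi>_def)

text \<open>Zeros are allowed in \<open>a\<close>, which stands for a padded list, and
  \<open>nt\<close> excludes the case of equality. The number of entries of \<open>a\<close> after
  the first difference decides: none contradicts the sums, one is a matter of balancing, and more
  require the spectral comparison. The hypothesis \<open>path\<close> will come from an
  isomorphism.\<close>

lemma rho_less_of_first_difference:
  assumes path: "\<And>x y x' y'. \<nexists>v. (u, v) \<in> parcs G \<Longrightarrow> x + y = x' + y' \<Longrightarrow> R [x, y] = R [x', y']"
    and a: "sorted a" and b: "sorted b" "\<forall>x\<in>set b. 0 < x" and len: "length a = length b"
    and sum: "sum_list a = sum_list b"
    and i: "i < length a" "take i a = take i b" "a ! i < b ! i"
    and nt: "length b = 2 \<Longrightarrow> \<exists>v. (u, v) \<in> parcs G"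
  shows "R a < R b"
proof -
  define pre s l0 ys where "pre = take i a" and "s = a ! i" and "l0 = drop (Suc i) a" and "ys = drop i b"
  have a_eq: "a = pre @ s # l0" unfolding pre_def s_def l0_def using i(1) by (rule id_take_nth_drop)
  have b_eq: "b = pre @ ys" unfolding pre_def ys_def i(2) by simp
  have ys_len: "length ys = Suc (length l0)" using len a_eq b_eq by (metis length_append length_Cons add_left_cancel)
  have ys_sum: "sum_list ys = s + sum_list l0"
    using sum unfolding a_eq b_eq by simp
  have ys_hd: "hd ys = b ! i" unfolding ys_def using i(1) len by (simp add: hd_drop_conv_nth)
  have ys_ge: "Suc s \<le> y" if "y \<in> set ys" for y
  proof -
    have "sorted ys" using b(1) b_eq by (simp add: sorted_append)
    then have "hd ys \<le> y" using that by (cases ys) auto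
    then show ?thesis using ys_hd i(3) by (simp add: s_def)
  qed
  have pre_pos: "\<forall>x\<in>set pre. 0 < x" using b(2) b_eq by auto
  \<comment> \<open>\<open>remdups_adj.cases\<close> merely distinguishes empty, one-element and
    longer lists.\<close>
  have "2 \<le> length l0 \<or> (\<exists>y. l0 = [y]) \<or> l0 = []"
    by (cases l0 rule: remdups_adj.cases) auto
  then consider (nil) "l0 = []" | (one) y where "l0 = [y]" | (many) "2 \<le> length l0" by blast
  then show ?thesis
  proof cases
    case nil
    then obtain y where "ys = [y]" using ys_len by (cases ys) auto
    then show ?thesis using ys_sum nil ys_ge[of y] by simp
  next
    case (one y)
    then obtain x' y' where xy': "ys = [x', y']"
      using ys_len by (cases ys rule: remdups_adj.cases) auto
    have "nontrivial pre"
    proof (cases "pre = []")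
      case True
      then show ?thesis using nt xy' b_eq by (simp add: nontrivial_def)
    next
      case False
      then show ?thesis using pre_pos by (cases pre) (auto simp: nontrivial_def)
    qed
    then have "R (s # y # pre) < R (x' # y' # pre)"
      using ys_ge[of x'] ys_ge[of y'] xy' ys_sum one by (intro rho_split) auto
    moreover have "R a = R (s # y # pre)" by (rule R_cong) (simp add: a_eq one union_commute)
    moreover have "R b = R (x' # y' # pre)" by (rule R_cong) (simp add: b_eq xy' union_commute)
    ultimately show ?thesis by simp
  next
    case many
    obtain l M where lM: "l0 = l @ [M]" using many by (cases l0 rule: rev_cases) auto
    have l_ne: "l \<noteq> []" using many lM by auto
    have lM_le: "\<And>x. x \<in> set l \<Longrightarrow> x \<le> M" using a a_eq lM by (simp add: sorted_append)
    consider (big) "2 < R a" | (bigb) "R a \<le> 2" "2 < R b" | (small) "R a \<le> 2" "R b \<le> 2" by linarith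
    then show ?thesis
    proof cases
      case big
      then show ?thesis
        using a_eq lM b_eq l_ne lM_le ys_len ys_ge ys_sum
        by (intro rho_less_of_rho_gt_2[of a pre s l M b ys]) auto
    next
      case small
      \<comment> \<open>A path of length at least 1, 2 or 3 contributes at least 1 / 2, 2 / 3 or 3 /
        4. Under these bounds \<open>b\<close> has at most four entries and, unless \<open>a\<close>
        is a path and \<open>G\<close> a single vertex, is one of [1, 1, 1, 1], [1, 1, 1] and
        [2, 2, 2].\<close>
      have \<Phi>b: "\<Phi> 2 b \<le> 2" "(\<exists>v. (u, v) \<in> parcs G) \<Longrightarrow> \<Phi> 2 b \<le> 3 / 2"
        using rho_gt_2[of b] small(2) by force+
      have b3: "3 \<le> length b" using many len a_eq by simp
      have b4: "length b \<le> 4" using \<Phi>_2_ge[OF b(2)] \<Phi>b(1) by simp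
      have s0: "s = 0 \<Longrightarrow> pre = []"
        using a a_eq pre_pos by (cases pre) (auto simp: sorted_append)
      have edge4: "length b = 4 \<Longrightarrow> \<nexists>v. (u, v) \<in> parcs G"
        using \<Phi>_2_ge[OF b(2)] \<Phi>b(2) by fastforce
      \<comment> \<open>If \<open>G\<close> is a single vertex, a path may be split at \<open>u\<close> anywhere without changing \<open>R\<close>.\<close>
      have no_edge_path: "R a < R b" if ne: "\<nexists>v. (u, v) \<in> parcs G" and eq: "R a = R [x, y]" "x + y = sum_list b" for x y
      proof -
        obtain b1 b2 b' where bb: "b = b1 # b2 # b'"
          using b3 by (cases b rule: remdups_adj.cases) auto
        then have b'_ne: "b' \<noteq> []" using b3 by auto
        have S: "0 < sum_list b'" using bb b'_ne b(2) by (cases b') auto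
        have "R [x, y] = R [b1, b2 + sum_list b']" using eq(2) bb by (intro path[OF ne]) simp
        also have "\<dots> = R [0, b2 + sum_list b', b1]" by (rule R_cong) (use bb b(2) in simp)
        also have "\<dots> < R [b2, sum_list b', b1]"
          using b(2) bb S by (intro rho_split) (auto simp: nontrivial_def)
        also have "\<dots> = R ([b1, b2] @ [sum_list b'])" by (rule R_cong) (use S bb b(2) in simp)
        also have "\<dots> \<le> R ([b1, b2] @ b')"
          using b(2) bb b'_ne by (intro rho_merge_le) (auto simp: nontrivial_def)
        finally show ?thesis using eq bb by simp
      qed
      show ?thesis
      proof (cases "length b = 4")
        case True
        then obtain w x y z where b': "b = [w, x, y, z]"
          by (auto simp: numeral_eq_Suc length_Suc_conv)
        have "z = 1"
        proof (rule ccontr)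
          assume "z \<noteq> 1"
          then have "2 \<le> z" using b(2) b' by auto
          then show False
            using \<Phi>b(1) b(2) branch_2_ge[of 1 w] branch_2_ge[of 1 x] branch_2_ge[of 1 y] branch_2_ge[of 2 z]
            by (simp add: b' \<Phi>_def)
        qed
        then have b1: "b = [1, 1, 1, 1]" using b b' by auto
        have "ys \<noteq> []" using ys_len by auto
        then have "hd ys \<in> set ys" "hd ys \<in> set b" using b_eq by auto
        then have "s = 0" using ys_ge[of "hd ys"] b1 by auto
        then obtain x y z where a': "a = [0, x, y, z]"
          using s0 a_eq len b1 by (auto simp: numeral_eq_Suc length_Suc_conv)
        then have xyz: "x \<le> y" "y \<le> z" "x + y + z = 4" using a sum b1 by auto
        show ?thesis
        proof (cases "x = 0")
          case True
          have "R a = R [y, z]" by (rule R_cong) (simp add: a' True)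
          then show ?thesis using no_edge_path[of y z] edge4 b1 xyz True by simp
        next
          case False
          then have "x = 1" "y = 1" "z = 2" using xyz by auto
          then have "R a = R [0, 2, 1, 1]" by (intro R_cong) (simp add: a')
          also have "\<dots> < R [1, 1, 1, 1]" by (rule rho_split) (auto simp: nontrivial_def)
          finally show ?thesis by (simp add: b1)
        qed
      next
        case False
        then have len3: "length b = 3" using b3 b4 by simp
        then obtain b1 b2 b3 where b': "b = [b1, b2, b3]"
          by (auto simp: numeral_eq_Suc length_Suc_conv)
        have "length pre + length l0 = 2" using len3 len a_eq by simp
        then have "length pre = 0" using many by linarith
        then have pre: "pre = []" by simp
        then obtain x y where a': "a = [s, x, y]"
          using a_eq len len3 by (auto simp: numeral_eq_Suc length_Suc_conv)
        have xy: "s \<le> x" "x \<le> y" "s + x + y = b1 + b2 + b3" using a sum a' b' by auto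
        have bs: "Suc s \<le> b1" "b1 \<le> b2" "b2 \<le> b3" using ys_ge b_eq pre b' b by auto
        show ?thesis
        proof (cases "\<exists>v. (u, v) \<in> parcs G")
          case True
          have nt: "nontrivial k" for k using True by (simp add: nontrivial_def)
          have "b3 = 1"
          proof (rule ccontr)
            assume "b3 \<noteq> 1"
            then have "2 \<le> b3" using bs by auto
            then show False
              using \<Phi>b(2)[OF True] bs branch_2_ge[of 1 b1] branch_2_ge[of 1 b2] branch_2_ge[of 2 b3]
              by (simp add: b' \<Phi>_def)
          qed
          then have b1: "b = [1, 1, 1]" "s = 0" using bs b' by auto
          have step: "R [0, 2, 1] < R b" unfolding b1 by (rule rho_split) (auto simp: nt)
          show ?thesis
          proof (cases "x = 0")
            case True
            then have "R a = R [0, 3, 0]" using a' b1 b' xy by (intro R_cong) auto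
            also have "\<dots> < R [1, 2, 0]" by (rule rho_split) (auto simp: nt)
            also have "\<dots> = R [0, 2, 1]" by (rule R_cong) simp
            finally show ?thesis using step by simp
          next
            case False
            then have "x = 1" "y = 2" using xy b1 b' by auto
            then have "R a = R [0, 2, 1]" using a' b1 by (intro R_cong) auto
            then show ?thesis using step by simp
          qed
        next
          case no_edge: False
          show ?thesis
          proof (cases "s = 0")
            case True
            have "R a = R [x, y]" by (rule R_cong) (simp add: a' True)
            then show ?thesis using no_edge_path[of x y] no_edge xy b' True by simp
          next
            case False
            have "b3 = 2"
            proof (rule ccontr)
              assume "b3 \<noteq> 2"
              then have "3 \<le> b3" using bs False by auto
              then show False
                using \<Phi>b(1) bs False branch_2_ge[of 2 b1] branch_2_ge[of 2 b2] branch_2_ge[of 3 b3]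
                by (simp add: b' \<Phi>_def)
            qed
            \<comment> \<open>There remain [1, 1, 4] and [1, 2, 3] for \<open>a\<close>, and
              balancing leads from the former through the latter to \<open>b\<close>.\<close>
            then have b2: "b = [2, 2, 2]" "s = 1" using bs b' False by auto
            have step: "R [1, 3, 2] < R b" unfolding b2 by (rule rho_split) (auto simp: nontrivial_def)
            show ?thesis
            proof (cases "x = 1")
              case True
              then have "R a = R [1, 4, 1]" using a' b2 b' xy by (intro R_cong) auto
              also have "\<dots> < R [2, 3, 1]" by (rule rho_split) (auto simp: nontrivial_def)
              also have "\<dots> = R [1, 3, 2]" by (rule R_cong) simp
              finally show ?thesis using step by simp
            next
              case False
              then have "x = 2" "y = 3" using xy b2 b' by auto
              then have "R a = R [1, 3, 2]" using a' b2 by (intro R_cong) auto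
              then show ?thesis using step by simp
            qed
          qed
        qed
      qed
    qed simp
  qed
qed

end

section \<open>Isomorphisms\<close>

text \<open>An isomorphism in the library maps vertices and arcs separately. As arcs are pairs of
  vertices here, the vertex map determines the arc map.\<close>

lemma digraph_iso_pairI:
  assumes "pair_wf_digraph A" and "inj_on h (pverts A)" and "h ` pverts A = pverts B"
    and "map_prod h h ` parcs A = parcs B"
  shows "digraph_iso (with_proj A) (with_proj B)"
proof -
  interpret A: pair_wf_digraph A by fact
  let ?f = "\<lparr> iso_verts = h, iso_arcs = map_prod h h, iso_head = snd, iso_tail = fst \<rparr>"
  have "inj_on (map_prod h h) (pverts A \<times> pverts A)"
    using assms(2) by (rule map_prod_inj_on) fact
  then have "inj_on (map_prod h h) (parcs A)"
    by (rule inj_on_subset) (use A.in_arcsD1 A.in_arcsD2 in auto)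
  then have "A.digraph_isomorphism ?f"
    using assms(2) A.wf_digraph unfolding A.digraph_isomorphism_def by simp
  moreover have "with_proj B = app_iso ?f (with_proj A)"
    using assms(3,4) by (simp add: app_iso_def with_proj_def)
  ultimately show ?thesis unfolding digraph_iso_def by blast
qed

lemma digraph_iso_pairE:
  assumes "pair_wf_digraph A" and "digraph_iso (with_proj A) (with_proj B)"
  obtains h where "inj_on h (pverts A)" "h ` pverts A = pverts B" "map_prod h h ` parcs A = parcs B"
proof -
  interpret A: pair_wf_digraph A by fact
  obtain f where f: "A.digraph_isomorphism f" and B: "with_proj B = app_iso f (with_proj A)"
    using assms(2) unfolding digraph_iso_def by blast
  have tail: "iso_tail f = fst" and head: "iso_head f = snd"
    and verts: "iso_verts f ` pverts A = pverts B" and arcs: "iso_arcs f ` parcs A = parcs B"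
    using B by (simp_all add: app_iso_def with_proj_def)
  have "iso_arcs f e = map_prod (iso_verts f) (iso_verts f) e" if "e \<in> parcs A" for e
    using f that tail head unfolding A.digraph_isomorphism_def
    by (cases "iso_arcs f e") (auto simp: map_prod_def case_prod_unfold)
  then have "map_prod (iso_verts f) (iso_verts f) ` parcs A = parcs B"
    using arcs by (metis image_cong)
  with that[of "iso_verts f"] verts f show ?thesis unfolding A.digraph_isomorphism_def by simp
qed

text \<open>The eigenfunction of \<open>B\<close>, pulled back along the vertex bijection, is a test
  function on \<open>A\<close> with the same form and norm.\<close>

lemma rho_alpha_le_of_iso:
  assumes A: "pair_graph A" and B: "pair_graph B" and ne: "pverts B \<noteq> {}" and \<alpha>: "0 \<le> \<alpha>" "\<alpha> \<le> 1"
    and iso: "digraph_iso (with_proj A) (with_proj B)"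
  shows "rho_alpha \<alpha> B \<le> rho_alpha \<alpha> A"
proof -
  interpret A: pair_graph A by fact
  interpret B: pair_graph B by fact
  obtain h where h: "inj_on h (pverts A)" "h ` pverts A = pverts B" "map_prod h h ` parcs A = parcs B"
    using digraph_iso_pairE[OF A.pair_wf_digraph_axioms iso] .
  have inj: "inj_on (map_prod h h) (parcs A)"
    by (rule inj_on_subset[OF map_prod_inj_on[OF h(1) h(1)]]) (use A.in_arcsD1 A.in_arcsD2 in auto)
  obtain w where "\<And>v. 0 \<le> w v" and w1: "\<exists>v\<in>pverts B. 0 < w v"
    and ev: "\<And>v. v \<in> pverts B \<Longrightarrow> (\<Sum>z\<in>nbrs B v. \<alpha> * w v + (1 - \<alpha>) * w z) = rho_alpha \<alpha> B * w v"
    using rho_alpha_rayleigh[OF B ne \<alpha>] by metis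
  define N where "N = (\<Sum>v\<in>pverts B. (w v)\<^sup>2)"
  have NA: "(\<Sum>v\<in>pverts A. (w (h v))\<^sup>2) = N"
    unfolding N_def h(2)[symmetric] by (simp add: sum.reindex[OF h(1)])
  have "alpha_form \<alpha> B w = rho_alpha \<alpha> B * N"
    unfolding N_def by (rule alpha_form_eigenfunction[OF B ev])
  moreover have "alpha_form \<alpha> B w = alpha_form \<alpha> A (\<lambda>v. w (h v))"
    unfolding alpha_form_def h(3)[symmetric] by (subst sum.reindex[OF inj]) (simp add: case_prod_unfold)
  moreover have "pverts A \<noteq> {}" using ne h(2) by auto
  then have "alpha_form \<alpha> A (\<lambda>v. w (h v)) \<le> rho_alpha \<alpha> A * N"
    using rho_alpha_rayleigh[OF A _ \<alpha>] unfolding NA[symmetric] by meson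
  moreover have "0 < N"
  proof -
    obtain v where "v \<in> pverts B" "0 < w v" using w1 by blast
    then show ?thesis unfolding N_def by (intro sum_pos2[of _ v]) auto
  qed
  ultimately show ?thesis by simp
qed

lemma rho_alpha_iso:
  assumes A: "pair_graph A" and B: "pair_graph B" and ne: "pverts A \<noteq> {}" and \<alpha>: "0 \<le> \<alpha>" "\<alpha> \<le> 1"
    and iso: "digraph_iso (with_proj A) (with_proj B)"
  shows "rho_alpha \<alpha> A = rho_alpha \<alpha> B"
proof -
  interpret A: pair_graph A by fact
  have "pverts B \<noteq> {}"
    using digraph_iso_pairE[OF A.pair_wf_digraph_axioms iso] ne by (metis image_is_empty)
  moreover have "digraph_iso (with_proj B) (with_proj A)"
    using iso A.wf_digraph by (rule digraph_iso_swap[rotated])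
  ultimately show ?thesis
    using rho_alpha_le_of_iso[OF A B _ \<alpha> iso] rho_alpha_le_of_iso[OF B A ne \<alpha>] by (intro antisym) auto
qed

text \<open>A normal form for two paths appended to a single vertex: it depends only on the sum of
  their lengths.\<close>

definition path_graph :: "nat \<Rightarrow> nat pair_pre_digraph" where
  "path_graph n = \<lparr> pverts = {..n}, parcs = (\<lambda>j. (j, Suc j)) ` {..<n} \<union> (\<lambda>j. (Suc j, j)) ` {..<n} \<rparr>"

context rooted_graph
begin

lemma no_edge_imp_K1:
  assumes "\<nexists>v. (u, v) \<in> parcs G"
  shows "pverts G = {u}" "parcs G = {}"
proof -
  have "z \<in> {u}" if "z \<in> pverts G" for z
    using connected_closed_set[OF G connected, of u "{u}" z] that u assms by blast
  then show V: "pverts G = {u}" using u by blast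
  show "parcs G = {}"
  proof (rule ccontr)
    assume "parcs G \<noteq> {}"
    then obtain a b where "(a, b) \<in> parcs G" by auto
    then show False using in_arcsD1[of a b] V assms by auto
  qed
qed

lemma complete_1_iff: "complete_digraph 1 (with_proj G) \<longleftrightarrow> (\<nexists>v. (u, v) \<in> parcs G)"
proof
  assume "complete_digraph 1 (with_proj G)"
  then have "card (pverts G) = 1" "parcs G = {(a, b). (a, b) \<in> pverts G \<times> pverts G \<and> a \<noteq> b}"
    unfolding complete_digraph_pair_def by auto
  then show "\<nexists>v. (u, v) \<in> parcs G" using u by (auto simp: card_1_singleton_iff)
next
  assume "\<nexists>v. (u, v) \<in> parcs G"
  from no_edge_imp_K1[OF this] show "complete_digraph 1 (with_proj G)"
    unfolding complete_digraph_pair_def by auto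
qed

lemma path_iso_path_graph:
  assumes ne: "\<nexists>v. (u, v) \<in> parcs G"
  shows "digraph_iso (with_proj (H [x, y])) (with_proj (path_graph (x + y)))"
proof (rule digraph_iso_pairI)
  interpret H: pair_graph "H [x, y]" by (rule H)
  show "pair_wf_digraph (H [x, y])" by (rule H.pair_wf_digraph_axioms)
  \<comment> \<open>The root receives the number \<open>x\<close>; the first path is numbered
    downwards from it, the second upwards.\<close>
  define h where "h = case_sum (\<lambda>_::'a. x) (\<lambda>(i, j). if i = (0::nat) then x - j else x + j)"
  have h0: "h (path_vertex u 0 j) = x - j" and h1: "h (path_vertex u (Suc 0) j) = x + j" for j
    by (auto simp: h_def path_vertex_def)
  have i2: "i < length [x, y] \<longleftrightarrow> i = 0 \<or> i = Suc 0" for i by auto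
  have V: "pverts (H [x, y]) = path_vertex u 0 ` {..x} \<union> path_vertex u (Suc 0) ` {..y}"
  proof -
    have "{path_vertex u i j |i j. (i = 0 \<or> i = Suc 0) \<and> j \<le> [x, y] ! i}
        = path_vertex u 0 ` {..[x, y] ! 0} \<union> path_vertex u (Suc 0) ` {..[x, y] ! Suc 0}" by blast
    moreover have "Inl u \<in> path_vertex u 0 ` {..x}"
      by (auto simp: path_vertex_def image_iff intro!: bexI[of _ 0])
    ultimately show ?thesis unfolding append_paths_def no_edge_imp_K1[OF ne] i2 by auto
  qed
  have arcs: "{f i j |i j. i < length [x, y] \<and> j < [x, y] ! i}
      = f 0 ` {..<[x, y] ! 0} \<union> f (Suc 0) ` {..<[x, y] ! Suc 0}"
    for f :: "nat \<Rightarrow> nat \<Rightarrow> ('a + nat \<times> nat) \<times> ('a + nat \<times> nat)"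
    unfolding i2 by blast
  have E: "parcs (H [x, y]) =
      (\<lambda>j. (path_vertex u 0 j, path_vertex u 0 (Suc j))) ` {..<x} \<union> (\<lambda>j. (path_vertex u 0 (Suc j), path_vertex u 0 j)) ` {..<x}
      \<union> (\<lambda>j. (path_vertex u (Suc 0) j, path_vertex u (Suc 0) (Suc j))) ` {..<y}
      \<union> (\<lambda>j. (path_vertex u (Suc 0) (Suc j), path_vertex u (Suc 0) j)) ` {..<y}"
    unfolding append_paths_def no_edge_imp_K1[OF ne] arcs by auto
  show "inj_on h (pverts (H [x, y]))"
    unfolding V by (auto simp: inj_on_def h0 h1) (auto simp: path_vertex_def)
  have "(\<lambda>j. x - j) ` {..x} = {..x}"
  proof (intro equalityI subsetI)
    fix z assume "z \<in> {..x}"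
    then show "z \<in> (\<lambda>j. x - j) ` {..x}" by (intro image_eqI[of _ _ "x - z"]) auto
  qed auto
  moreover have "(\<lambda>j. x + j) ` {..y} = {x..x + y}"
  proof (intro equalityI subsetI)
    fix z assume "z \<in> {x..x + y}"
    then show "z \<in> (\<lambda>j. x + j) ` {..y}" by (intro image_eqI[of _ _ "z - x"]) auto
  qed auto
  ultimately show "h ` pverts (H [x, y]) = pverts (path_graph (x + y))"
    unfolding V image_Un image_image h0 h1 by (auto simp: path_graph_def)
  have dn: "(\<lambda>j. f (x - j) (x - Suc j)) ` {..<x} = (\<lambda>j. f (Suc j) j) ` {..<x}" for f :: "nat \<Rightarrow> nat \<Rightarrow> nat \<times> nat"
  proof -
    have "{..<x} = (\<lambda>j. x - Suc j) ` {..<x}"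
    proof (intro equalityI subsetI)
      fix z assume "z \<in> {..<x}"
      then show "z \<in> (\<lambda>j. x - Suc j) ` {..<x}" by (intro image_eqI[of _ _ "x - Suc z"]) auto
    qed auto
    then have "(\<lambda>j. f (Suc j) j) ` {..<x} = (\<lambda>j. f (Suc j) j) ` (\<lambda>j. x - Suc j) ` {..<x}"
      by (rule arg_cong)
    also have "\<dots> = (\<lambda>j. f (Suc (x - Suc j)) (x - Suc j)) ` {..<x}"
      by (simp only: image_image)
    also have "\<dots> = (\<lambda>j. f (x - j) (x - Suc j)) ` {..<x}"
      by (intro image_cong refl) (simp add: Suc_diff_Suc)
    finally show ?thesis by simp
  qed
  have up: "(\<lambda>j. f j (Suc j)) ` {..<x} \<union> (\<lambda>j. f (x + j) (x + Suc j)) ` {..<y} = (\<lambda>j. f j (Suc j)) ` {..<x + y}"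
    for f :: "nat \<Rightarrow> nat \<Rightarrow> nat \<times> nat"
  proof -
    have "{..<x + y} = {..<x} \<union> (\<lambda>j. x + j) ` {..<y}"
    proof (intro equalityI subsetI)
      fix z assume "z \<in> {..<x + y}"
      then show "z \<in> {..<x} \<union> (\<lambda>j. x + j) ` {..<y}"
        by (cases "z < x") (auto intro!: image_eqI[of _ _ "z - x"])
    qed auto
    then show ?thesis by (simp add: image_Un image_image)
  qed
  show "map_prod h h ` parcs (H [x, y]) = parcs (path_graph (x + y))"
    unfolding E image_Un image_image map_prod_simp h0 h1
      dn[of "\<lambda>a b. (a, b)"] dn[of "\<lambda>a b. (b, a)"]
    by (simp add: path_graph_def up[of "\<lambda>a b. (a, b)", symmetric] up[of "\<lambda>a b. (b, a)", symmetric] Un_ac)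
qed

lemma path_iso:
  assumes ne: "\<nexists>v. (u, v) \<in> parcs G" and "x + y = x' + y'"
  shows "digraph_iso (with_proj (H [x, y])) (with_proj (H [x', y']))"
proof -
  interpret H': pair_graph "H [x', y']" by (rule H)
  have "digraph_iso (with_proj (path_graph (x' + y'))) (with_proj (H [x', y']))"
    using H'.wf_digraph path_iso_path_graph[OF ne] by (rule digraph_iso_swap)
  then show ?thesis
    using path_iso_path_graph[OF ne, of x y] assms(2) digraph_iso_trans by metis
qed

text \<open>An equality of graphs: a path of length 0 consists of the root, and at the end of the
  list it shifts no index of another path.\<close>

lemma append_paths_zero: "H (xs @ [0]) = H xs"
proof -
  have "path_vertex u i 0 \<in> Inl ` pverts G" for i using u by (simp add: path_vertex_def)
  then show ?thesis
    unfolding append_paths_def by (auto simp: nth_append less_Suc_eq)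
qed

lemma R_iso:
  assumes "digraph_iso (with_proj (H xs)) (with_proj (H ys))"
  shows "R xs = R ys"
  using rho_alpha_iso[OF H H pverts_H_ne _ _ assms] \<alpha> by simp

lemma rho_less_shortlex:
  assumes a: "a \<in> partitions n" and b: "b \<in> partitions n" and ab: "a \<prec>\<^sub>l\<^sub>e\<^sub>x b"
    and nt: "length b = 2 \<Longrightarrow> \<exists>v. (u, v) \<in> parcs G"
  shows "R a < R b"
proof -
  \<comment> \<open>The zeros go in front. This keeps the list sorted, and if \<open>a\<close> is
    shorter than \<open>b\<close>, the first difference is at index 0, where 0 meets a positive
    entry.\<close>
  define a' where "a' = replicate (length b - length a) 0 @ a"
  have len: "length a \<le> length b" using ab unfolding shortlex_iff by auto
  have "R a = R a'" by (rule R_cong) (simp add: a'_def)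
  also have "\<exists>i<length a'. take i a' = take i b \<and> a' ! i < b ! i"
  proof (cases "length a < length b")
    case True
    then have "b ! 0 \<in> set b" by (intro nth_mem) linarith
    then have "0 < b ! 0" using b by (simp add: partitions_def)
    with True show ?thesis by (intro exI[of _ 0]) (auto simp: a'_def nth_append)
  next
    case False
    then show ?thesis using ab unfolding shortlex_iff by (auto simp: a'_def)
  qed
  then obtain i where "i < length a'" "take i a' = take i b" "a' ! i < b ! i" by blast
  then have "R a' < R b"
    using a b len path_iso R_iso nt
    by (intro rho_less_of_first_difference[of a' b i]) (auto simp: partitions_def a'_def sorted_append)
  finally show ?thesis .
qed

lemma path_iso_of_length_2:
  assumes ne: "\<nexists>v. (u, v) \<in> parcs G" and "0 < n" and a: "a \<in> partitions n" and b: "b \<in> partitions n"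
    and ab: "a \<prec>\<^sub>l\<^sub>e\<^sub>x b" and len: "length b = 2"
  shows "digraph_iso (with_proj (H a)) (with_proj (H b))"
proof -
  obtain x' y' where b': "b = [x', y']" using len by (auto simp: numeral_eq_Suc length_Suc_conv)
  have "length a \<le> 2" "a \<noteq> []" using ab len a \<open>0 < n\<close> unfolding shortlex_iff partitions_def by auto
  then consider x where "a = [x]" | x y where "a = [x, y]"
    by (cases a rule: remdups_adj.cases) auto
  then obtain x y where "H a = H [x, y]" "x + y = n"
  proof cases
    case (1 x)
    then show ?thesis using that[of x 0] append_paths_zero[of "[x]"] a by (simp add: partitions_def)
  next
    case (2 x y)
    then show ?thesis using that[of x y] a by (simp add: partitions_def)
  qed
  then show ?thesis using path_iso[OF ne, of x y x' y'] b b' by (simp add: partitions_def)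
qed

end

theorem theorem2p2:
  fixes G :: "'a pair_pre_digraph" and u :: 'a and n :: nat
    and a b :: "nat list" and \<alpha> :: real
  assumes "pair_graph G" and "connected (with_proj G)" and "u \<in> pverts G"
    and "n > 0"
    and "a \<in> partitions n" and "b \<in> partitions n" and "a \<prec>\<^sub>l\<^sub>e\<^sub>x b"
    and "0 \<le> \<alpha>" and "\<alpha> < 1"
  shows "rho_alpha \<alpha> (append_paths G a u) \<le> rho_alpha \<alpha> (append_paths G b u) \<and>
    (rho_alpha \<alpha> (append_paths G a u) = rho_alpha \<alpha> (append_paths G b u) \<longleftrightarrow>
      digraph_iso (with_proj (append_paths G a u)) (with_proj (append_paths G b u))) \<and>
    (digraph_iso (with_proj (append_paths G a u)) (with_proj (append_paths G b u)) \<longleftrightarrow>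
      complete_digraph 1 (with_proj G) \<and> length b = 2)"
proof -
  interpret rooted_graph G u \<alpha> by (rule rooted_graph.intro) fact+
  show ?thesis
  proof (cases "complete_digraph 1 (with_proj G) \<and> length b = 2")
    case True
    then have "digraph_iso (with_proj (H a)) (with_proj (H b))"
      using path_iso_of_length_2[OF _ assms(4-7)] complete_1_iff by blast
    then show ?thesis using True R_iso by simp
  next
    case False
    then have "R a < R b"
      using rho_less_shortlex[OF assms(5-7)] complete_1_iff by blast
    moreover from this have "\<not> digraph_iso (with_proj (H a)) (with_proj (H b))"
      using R_iso by force
    ultimately show ?thesis using False by simp
  qed
qed

end
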